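(* For every integer $k\ge 2$, the integer-valued function $R_k$ on chord diagrams is a weight system, that is, it satisfies the $4$-term relation: for every chord diagram $d$ and every pair of distinct chords $A,B$ of $d$ having neighboring ends, $$R_k(d)-R_k(d'_{AB})=R_k(\tilde d_{AB})-R_k(\tilde d'_{AB}).$$
   Context: A chord diagram of order $n$ is an oriented circle (positive direction $=$ counterclockwise) with $2n$ pairwise distinct points split into $n$ disjoint (unordered) pairs, considered up to orientation-preserving diffeomorphisms of the circle; each pair is called a chord and its two points are its ends. Two distinct chords intersect if their ends alternate along the circle. The intersection graph $\gamma(d)$ of a chord diagram $d$ is the simple graph whose vertices are the chords of $d$, two vertices being adjacent iff the corresponding chords intersect. Operations in the $4$-term relation. Let $A,B$ be distinct chords of $d$ with neighboring ends: an end $a$ of $A$ and an end $b_1$ of $B$ are such that one of the two open arcs of the circle between them contains no end of any chord. Let $b_2$ be the other end of $B$. The diagram $d'_{AB}$ is obtained from $d$ by exchanging the positions of the neighboring points $a$ and $b_1$ (all other ends being fixed). The diagram $\tilde d_{AB}$ is obtained from $d$ by moving the end $a$ of $A$ along the chord $B$ to a place immediately next to $b_2$, on the same side of $B$: if $a$ immediately precedes $b_1$ in the positive direction, then $a$ is moved to the position immediately following $b_2$; if $a$ immediately follows $b_1$, then $a$ is moved to the position immediately preceding $b_2$ (all other ends being fixed). The diagram $\tilde d'_{AB}$ is obtained from $\tilde d_{AB}$ by exchanging the positions of the neighboring points $a$ and $b_2$. A weight system is a function $f$ on chord diagrams such that $f(d)-f(d'_{AB})=f(\tilde d_{AB})-f(\tilde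 d'_{AB})$ for all such $d,A,B$. Directed intersection graph. Choose an orientation of each chord of $d$, i.e. declare one end its beginning and the other its end. Each edge of $\gamma(d)$ joining intersecting chords $A,B$ is then oriented from $A$ to $B$ if the beginning of $B$ belongs to the arc of the circle that starts at the beginning of $A$ and goes in the positive direction to the end of $A$ (otherwise it is oriented from $B$ to $A$). Oriented edges are called arrows. Signs. A $2k$-gon (circuit of length $2k$) in a directed graph is a cycle subgraph of length $2k$ with $2k$ pairwise distinct vertices in the underlying simple graph (counted without regard to starting vertex and direction of traversal). It is positively oriented if, for a chosen direction of traversal, the number of its arrows oriented in that direction is even, and negatively oriented otherwise; since the total number of arrows is even, this does not depend on the direction of traversal. Definition of $R_k$. For $k=2,3,4,\dots$, $R_k(d)$ is the number of positively oriented $2k$-gons minus the number of negatively oriented $2k$-gons in the directed intersection graph $\gamma(d)$, for an arbitrarily chosen orientation of the chords of $d$; the value does not depend on this choice. *)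

theory Defs
  imports
    "HOL-Library.Disjoint_Sets"
    "HOL-Combinatorics.Transposition"
begin

section \<open>Chord diagrams\<close>

text \<open>
  Up to orientation-preserving diffeomorphism, the \<open>m = 2 * n\<close> points on the oriented circle
  may be taken to be \<open>0, \<dots>, m - 1\<close>, met in this cyclic order when going in the positive direction.
  What remains of the diffeomorphisms is then the group of rotations of \<open>{..<m}\<close>. All constants
  below that take an argument \<open>m\<close> refer to this circle with \<open>m\<close> points.
\<close>

definition chord_system :: "nat set set \<Rightarrow> bool" where
  "chord_system D \<longleftrightarrow> partition_on {..<2 * card D} D \<and> (\<forall>C\<in>D. card C = 2)"

definition relocate :: "(nat \<Rightarrow> nat) \<Rightarrow> nat set set \<Rightarrow> nat set set" where
  "relocate \<pi> D = (\<lambda>C. \<pi> ` C) ` D"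

definition rotation :: "nat \<Rightarrow> nat \<Rightarrow> nat \<Rightarrow> nat" where
  "rotation m r x = (x + r) mod m"

definition chord_equiv :: "nat set set \<Rightarrow> nat set set \<Rightarrow> bool" where
  "chord_equiv D D' \<longleftrightarrow> chord_system D \<and> chord_system D' \<and>
     (\<exists>r. D' = relocate (rotation (2 * card D) r) D)"

text \<open>The points of the open arc that starts at \<open>x\<close> and goes in the positive direction to \<open>y\<close>.\<close>

definition arc :: "nat \<Rightarrow> nat \<Rightarrow> nat \<Rightarrow> nat set" where
  "arc m x y = (if x < y then {x<..<y} else {x<..<m} \<union> {..<y})"


section \<open>Directed intersection graphs and the signed number of polygons\<close>

definition chords_intersect :: "nat \<Rightarrow> nat set \<Rightarrow> nat set \<Rightarrow> bool" where
  "chords_intersect m A B \<longleftrightarrow>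
     (\<exists>a a' b b'. A = {a, a'} \<and> B = {b, b'} \<and> b \<in> arc m a a' \<and> b' \<in> arc m a' a)"

text \<open>An orientation of the chords is given by the function \<open>s\<close> selecting the beginning of each chord.\<close>

definition chord_orientation :: "nat set set \<Rightarrow> (nat set \<Rightarrow> nat) \<Rightarrow> bool" where
  "chord_orientation D s \<longleftrightarrow> (\<forall>C\<in>D. s C \<in> C)"

definition chord_end :: "(nat set \<Rightarrow> nat) \<Rightarrow> nat set \<Rightarrow> nat" where
  "chord_end s C = the_elem (C - {s C})"

text \<open>
  A directed graph is given by its set of arrows. Each pair of intersecting chords is joined by
  exactly one arrow, see \<open>arrow_iff_not_reverse\<close> below.
\<close>

definition directed_intersection_graph ::
    "nat set set \<Rightarrow> (nat set \<Rightarrow> nat) \<Rightarrow> (nat set \<times> nat set) set" where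
  "directed_intersection_graph D s =
     {(A, B). A \<in> D \<and> B \<in> D \<and> chords_intersect (2 * card D) A B \<and>
        s B \<in> arc (2 * card D) (s A) (chord_end s A)}"

text \<open>
  A traversal of a circuit is the list of its vertices, the last one being followed by the first
  one; the circuit itself is the set of its (unoriented) edges. For circuits of even length at
  least 4 in a graph without pairs of opposite arrows, the parity of the number of forward arrows
  is the same for all traversals of the circuit, so that it suffices to consider some traversal.
\<close>

definition traversal :: "('v \<times> 'v) set \<Rightarrow> 'v list \<Rightarrow> bool" where
  "traversal G vs \<longleftrightarrow> distinct vs \<and>
     (\<forall>i<length vs. (vs ! i, vs ! (Suc i mod length vs)) \<in> G \<union> G\<inverse>)"

definition circuit_edges :: "'v list \<Rightarrow> 'v set set" where
  "circuit_edges vs = (\<lambda>i. {vs ! i, vs ! (Suc i mod length vs)}) ` {..<length vs}"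

definition forward_arrows :: "('v \<times> 'v) set \<Rightarrow> 'v list \<Rightarrow> nat" where
  "forward_arrows G vs = card {i. i < length vs \<and> (vs ! i, vs ! (Suc i mod length vs)) \<in> G}"

definition polygons :: "('v \<times> 'v) set \<Rightarrow> nat \<Rightarrow> 'v set set set" where
  "polygons G l = {circuit_edges vs | vs. traversal G vs \<and> length vs = l}"

definition positive_polygons :: "('v \<times> 'v) set \<Rightarrow> nat \<Rightarrow> 'v set set set" where
  "positive_polygons G l =
     {circuit_edges vs | vs. traversal G vs \<and> length vs = l \<and> even (forward_arrows G vs)}"

definition signed_polygon_count :: "('v \<times> 'v) set \<Rightarrow> nat \<Rightarrow> int" where
  "signed_polygon_count G l =
     int (card (positive_polygons G l)) - int (card (polygons G l - positive_polygons G l))"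


section \<open>Passing to diagrams up to rotation\<close>

subsection \<open>Basic facts\<close>

lemma chord_systemD:
  assumes "chord_system D"
  shows "\<Union>D = {..<2 * card D}" "disjoint D"
    "\<And>C. C \<in> D \<Longrightarrow> card C = 2" "\<And>C x. C \<in> D \<Longrightarrow> x \<in> C \<Longrightarrow> x < 2 * card D"
proof -
  show 1: "\<Union>D = {..<2 * card D}" and "disjoint D" and "\<And>C. C \<in> D \<Longrightarrow> card C = 2"
    using assms unfolding chord_system_def partition_on_def by blast+
  fix C x assume "C \<in> D" "x \<in> C"
  then have "x \<in> {..<2 * card D}" unfolding 1[symmetric] by blast
  then show "x < 2 * card D" by simp
qed

lemma chord_end:
  assumes "card C = 2" "s C \<in> C"
  shows "C = {s C, chord_end s C}" "chord_end s C \<noteq> s C"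
proof -
  have "card (C - {s C}) = 1"
    using assms by (simp add: card_Diff_singleton)
  then obtain y where y: "C - {s C} = {y}"
    using card_1_singletonE by blast
  then have "chord_end s C = y"
    by (simp add: chord_end_def)
  then show "C = {s C, chord_end s C}" "chord_end s C \<noteq> s C"
    using y assms(2) by blast+
qed

lemma relocate_id:
  assumes "chord_system D" "\<And>x. x < 2 * card D \<Longrightarrow> \<pi> x = x"
  shows "relocate \<pi> D = D"
proof -
  have "\<pi> ` C = C" if "C \<in> D" for C
    using assms(2)[OF chord_systemD(4)[OF assms(1) that]] by force
  then show ?thesis
    by (simp add: relocate_def)
qed

lemma chords_intersect_iff:
  assumes "A = {a, a'}" "B = {b, b'}"
  shows "chords_intersect m A B \<longleftrightarrow>
     b \<in> arc m a a' \<and> b' \<in> arc m a' a \<or> b' \<in> arc m a a' \<and> b \<in> arc m a' a"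
    (is "_ \<longleftrightarrow> ?alt")
proof
  assume "chords_intersect m A B"
  then obtain c c' d d' where *: "A = {c, c'}" "B = {d, d'}" "d \<in> arc m c c'" "d' \<in> arc m c' c"
    unfolding chords_intersect_def by (elim exE conjE)
  have "a = c \<and> a' = c' \<or> a = c' \<and> a' = c" "b = d \<and> b' = d' \<or> b = d' \<and> b' = d"
    using assms(1)[unfolded *(1)] assms(2)[unfolded *(2)] by (metis doubleton_eq_iff)+
  then show ?alt
    using *(3,4) by (elim disjE conjE) simp_all
next
  have "{b, b'} = {b', b}" by (rule insert_commute)
  moreover assume ?alt
  ultimately show "chords_intersect m A B"
    unfolding chords_intersect_def assms by metis
qed

lemma mem_arc_iff:
  assumes "x \<noteq> y" "z < m"
  shows "z \<in> arc m x y \<longleftrightarrow> x < y \<and> x < z \<and> z < y \<or> y < x \<and> (x < z \<or> z < y)"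
  using assms by (auto simp: arc_def)

lemma alternating_arcs:
  assumes "b \<in> arc m a a'" "b' \<in> arc m a' a" "a \<noteq> a'" "a < m" "a' < m" "b < m" "b' < m"
  shows "a' \<in> arc m b b'" "a \<in> arc m b' b" "a \<notin> arc m b b'" "a' \<notin> arc m b' b" "b \<noteq> b'"
        "b \<notin> arc m a' a" "b' \<notin> arc m a a'"
proof -
  have *: "a < a' \<and> a < b \<and> b < a' \<or> a' < a \<and> (a < b \<or> b < a')"
          "a' < a \<and> a' < b' \<and> b' < a \<or> a < a' \<and> (a' < b' \<or> b' < a)"
    using assms by (simp_all add: mem_arc_iff)
  then show **: "b \<noteq> b'" by linarith
  then show "a' \<in> arc m b b'" "a \<in> arc m b' b" "a \<notin> arc m b b'" "a' \<notin> arc m b' b"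
    "b \<notin> arc m a' a" "b' \<notin> arc m a a'"
    unfolding mem_arc_iff[OF ** assms(4)] mem_arc_iff[OF ** assms(5)]
      mem_arc_iff[OF **[symmetric] assms(4)] mem_arc_iff[OF **[symmetric] assms(5)]
      mem_arc_iff[OF assms(3) assms(7)] mem_arc_iff[OF assms(3)[symmetric] assms(6)]
    using * by linarith+
qed

lemma chords_intersect_sym:
  assumes "chord_system D" "A \<in> D" "B \<in> D" "chords_intersect (2 * card D) A B"
  shows "chords_intersect (2 * card D) B A"
proof -
  obtain a a' b b' where *: "A = {a, a'}" "B = {b, b'}"
    "b \<in> arc (2 * card D) a a'" "b' \<in> arc (2 * card D) a' a"
    using assms(4) unfolding chords_intersect_def by blast
  have lt: "a < 2 * card D" "a' < 2 * card D" "b < 2 * card D" "b' < 2 * card D"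
    using * assms(2,3) chord_systemD(4)[OF assms(1)] by blast+
  have "a \<noteq> a'"
    using *(1) assms(2) chord_systemD(3)[OF assms(1), of A] by auto
  from alternating_arcs(1,2)[OF *(3,4) this lt] show ?thesis
    unfolding chords_intersect_def using *(1,2) by (metis insert_commute)
qed

lemma arrow_iff_not_reverse:
  assumes "chord_system D" "chord_orientation D s" "A \<in> D" "B \<in> D"
    and "chords_intersect (2 * card D) A B"
  shows "(A, B) \<in> directed_intersection_graph D s \<longleftrightarrow>
         (B, A) \<notin> directed_intersection_graph D s"
proof -
  let ?m = "2 * card D"
  have A: "A = {s A, chord_end s A}" "chord_end s A \<noteq> s A"
    and B: "B = {s B, chord_end s B}" "chord_end s B \<noteq> s B"
    using assms chord_end chord_systemD(3) by (auto simp: chord_orientation_def)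
  have lt: "s A < ?m" "chord_end s A < ?m" "s B < ?m" "chord_end s B < ?m"
    using A(1) B(1) chord_systemD(4)[OF assms(1)] assms(3,4) by blast+
  have 1: "chords_intersect ?m A B \<longleftrightarrow>
      s B \<in> arc ?m (s A) (chord_end s A) \<and> chord_end s B \<in> arc ?m (chord_end s A) (s A) \<or>
      chord_end s B \<in> arc ?m (s A) (chord_end s A) \<and> s B \<in> arc ?m (chord_end s A) (s A)"
    by (rule chords_intersect_iff[OF A(1) B(1)])
  have 2: "chords_intersect ?m B A"
    using chords_intersect_sym assms by blast
  have "s B \<in> arc ?m (s A) (chord_end s A) \<longleftrightarrow> s A \<notin> arc ?m (s B) (chord_end s B)"
    using assms(5) unfolding 1
    using alternating_arcs[OF _ _ A(2)[symmetric] lt(1,2) lt(3,4)]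
      alternating_arcs[OF _ _ A(2)[symmetric] lt(1,2) lt(4,3)] by blast
  then show ?thesis
    using assms(3-5) 2 by (simp add: directed_intersection_graph_def)
qed

lemma underlying_graph:
  assumes "chord_system D" "chord_orientation D s"
  shows "(A, B) \<in> directed_intersection_graph D s \<union> (directed_intersection_graph D s)\<inverse>
    \<longleftrightarrow> A \<in> D \<and> B \<in> D \<and> chords_intersect (2 * card D) A B"
proof -
  have "A \<in> D \<and> B \<in> D \<and> chords_intersect (2 * card D) A B"
    if "(A, B) \<in> directed_intersection_graph D s \<or> (B, A) \<in> directed_intersection_graph D s"
    using that chords_intersect_sym[OF assms(1)] unfolding directed_intersection_graph_def by blast
  moreover have "(A, B) \<in> directed_intersection_graph D s \<or> (B, A) \<in> directed_intersection_graph D s"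
    if "A \<in> D" "B \<in> D" "chords_intersect (2 * card D) A B"
    using arrow_iff_not_reverse[OF assms that] by blast
  ultimately show ?thesis
    by blast
qed


subsection \<open>Independence of the orientation of the chords\<close>

lemma minus_one_power_forward_arrows:
  "(-1) ^ forward_arrows G vs =
     (\<Prod>i<length vs. if (vs ! i, vs ! (Suc i mod length vs)) \<in> G then -1 else (1::int))"
proof -
  have "(\<Prod>i<length vs. if (vs ! i, vs ! (Suc i mod length vs)) \<in> G then -1 else (1::int))
      = (\<Prod>i\<in>{i\<in>{..<length vs}. (vs ! i, vs ! (Suc i mod length vs)) \<in> G}. -1)"
    by (rule prod.inter_filter[symmetric]) simp
  then show ?thesis
    by (simp add: forward_arrows_def)
qed

lemma prod_cyclic_shift:
  fixes g :: "nat \<Rightarrow> int"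
  shows "(\<Prod>i<l. g (Suc i mod l)) = (\<Prod>i<l. g i)"
proof (cases l)
  case (Suc k)
  have "(\<Prod>i<l. g (Suc i mod l)) = (\<Prod>i<k. g (Suc i mod l)) * g 0"
    by (simp add: Suc)
  also have "(\<Prod>i<k. g (Suc i mod l)) = (\<Prod>i<k. g (Suc i))"
    by (intro prod.cong) (auto simp: Suc)
  also have "(\<Prod>i<k. g (Suc i)) * g 0 = (\<Prod>i<l. g i)"
    unfolding Suc prod.lessThan_Suc_shift by simp
  finally show ?thesis .
qed simp

lemma arrow_change_orientation:
  assumes "chord_system D" "chord_orientation D s" "chord_orientation D s'"
    and "A \<in> D" "B \<in> D" "chords_intersect (2 * card D) A B"
  shows "(A, B) \<in> directed_intersection_graph D s' \<longleftrightarrow>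
     (((A, B) \<in> directed_intersection_graph D s) = ((s A = s' A) = (s B = s' B)))"
proof -
  let ?m = "2 * card D"
  have A: "A = {s A, chord_end s A}" "chord_end s A \<noteq> s A"
    and A': "A = {s' A, chord_end s' A}" "chord_end s' A \<noteq> s' A"
    and B: "B = {s B, chord_end s B}" "chord_end s B \<noteq> s B"
    and B': "B = {s' B, chord_end s' B}" "chord_end s' B \<noteq> s' B"
    using assms chord_end chord_systemD(3) by (auto simp: chord_orientation_def)
  have lt: "s A < ?m" "chord_end s A < ?m" "s B < ?m" "chord_end s B < ?m"
    using A(1) B(1) chord_systemD(4)[OF assms(1)] assms(4,5) by blast+
  have 1: "s B \<in> arc ?m (s A) (chord_end s A) \<and> chord_end s B \<in> arc ?m (chord_end s A) (s A) \<or>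
      chord_end s B \<in> arc ?m (s A) (chord_end s A) \<and> s B \<in> arc ?m (chord_end s A) (s A)"
    using chords_intersect_iff[OF A(1) B(1)] assms(6) by blast
  have disj: "x \<notin> arc ?m (chord_end s A) (s A)" if "x \<in> arc ?m (s A) (chord_end s A)" for x
    using that A(2) by (auto simp: arc_def split: if_splits)
  have sides: "s B \<in> arc ?m (chord_end s A) (s A) \<longleftrightarrow> s B \<notin> arc ?m (s A) (chord_end s A)"
    "chord_end s B \<in> arc ?m (s A) (chord_end s A) \<longleftrightarrow> s B \<notin> arc ?m (s A) (chord_end s A)"
    "chord_end s B \<in> arc ?m (chord_end s A) (s A) \<longleftrightarrow> s B \<in> arc ?m (s A) (chord_end s A)"
    using 1 disj by blast+
  have arrow: "(A, B) \<in> directed_intersection_graph D t \<longleftrightarrow> t B \<in> arc ?m (t A) (chord_end t A)" for t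
    using assms(4-6) by (simp add: directed_intersection_graph_def)
  have sA: "s' A = s A \<and> chord_end s' A = chord_end s A \<or> s' A = chord_end s A \<and> chord_end s' A = s A"
    using A A' by (metis doubleton_eq_iff)
  have sB: "s' B = s B \<or> s' B = chord_end s B"
    using B(1) B'(1) by (metis doubleton_eq_iff)
  show ?thesis
    unfolding arrow using sA sB
    by (elim disjE conjE) (simp_all add: sides A(2)[symmetric] B(2)[symmetric])
qed

lemma signed_polygon_count_orientation:
  assumes "chord_system D" "chord_orientation D s" "chord_orientation D s'"
  shows "signed_polygon_count (directed_intersection_graph D s) l =
         signed_polygon_count (directed_intersection_graph D s') l"
proof -
  let ?G = "directed_intersection_graph D s" and ?G' = "directed_intersection_graph D s'"
  have sym: "?G \<union> ?G\<inverse> = ?G' \<union> ?G'\<inverse>"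
    using underlying_graph[OF assms(1,2)] underlying_graph[OF assms(1,3)] by auto
  have trav: "traversal ?G = traversal ?G'"
    unfolding traversal_def sym ..
  have "even (forward_arrows ?G vs) \<longleftrightarrow> even (forward_arrows ?G' vs)" if vs: "traversal ?G vs" for vs
  proof -
    let ?l = "length vs"
    let ?t = "\<lambda>i. if s (vs ! i) = s' (vs ! i) then 1 else (-1::int)"
    have "(-1) ^ forward_arrows ?G' vs = (\<Prod>i<?l.
        (if (vs ! i, vs ! (Suc i mod ?l)) \<in> ?G then -1 else 1) * (?t i * ?t (Suc i mod ?l)))"
      unfolding minus_one_power_forward_arrows
    proof (intro prod.cong refl)
      fix i assume "i \<in> {..<?l}"
      then have "(vs ! i, vs ! (Suc i mod ?l)) \<in> ?G \<union> ?G\<inverse>"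
        using vs by (auto simp: traversal_def)
      then have *: "vs ! i \<in> D" "vs ! (Suc i mod ?l) \<in> D"
          "chords_intersect (2 * card D) (vs ! i) (vs ! (Suc i mod ?l))"
        using underlying_graph[OF assms(1,2)] by blast+
      show "(if (vs ! i, vs ! (Suc i mod ?l)) \<in> ?G' then -1 else 1) =
        (if (vs ! i, vs ! (Suc i mod ?l)) \<in> ?G then -1 else 1) * (?t i * ?t (Suc i mod ?l))"
        using arrow_change_orientation[OF assms *] by auto
    qed
    also have "\<dots> = (-1) ^ forward_arrows ?G vs * ((\<Prod>i<?l. ?t i) * (\<Prod>i<?l. ?t (Suc i mod ?l)))"
      unfolding minus_one_power_forward_arrows prod.distrib ..
    also have "(\<Prod>i<?l. ?t (Suc i mod ?l)) = (\<Prod>i<?l. ?t i)"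
      by (rule prod_cyclic_shift)
    also have "(\<Prod>i<?l. ?t i) * (\<Prod>i<?l. ?t i) = (\<Prod>i<?l. ?t i * ?t i)"
      by (rule prod.distrib[symmetric])
    also have "\<dots> = 1"
      by (intro prod.neutral) auto
    finally show ?thesis
      by (cases "even (forward_arrows ?G vs)"; cases "even (forward_arrows ?G' vs)") auto
  qed
  then have "positive_polygons ?G l = positive_polygons ?G' l"
    unfolding positive_polygons_def trav by blast
  moreover have "polygons ?G l = polygons ?G' l"
    unfolding polygons_def trav ..
  ultimately show ?thesis
    by (simp add: signed_polygon_count_def)
qed


subsection \<open>Invariance under rotation\<close>

lemma circuit_step_in:
  assumes "i < length vs"
  shows "vs ! i \<in> set vs" "vs ! (Suc i mod length vs) \<in> set vs"
proof -
  have "Suc i mod length vs < length vs"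
    by (rule mod_less_divisor) (use assms in linarith)
  then show "vs ! i \<in> set vs" "vs ! (Suc i mod length vs) \<in> set vs"
    using assms by (simp_all only: nth_mem)
qed

lemma circuit_step_map:
  assumes "i < length vs"
  shows "map h vs ! i = h (vs ! i)"
    "map h vs ! (Suc i mod length vs) = h (vs ! (Suc i mod length vs))"
proof -
  have "Suc i mod length vs < length vs"
    by (rule mod_less_divisor) (use assms in linarith)
  then show "map h vs ! i = h (vs ! i)"
    "map h vs ! (Suc i mod length vs) = h (vs ! (Suc i mod length vs))"
    using assms by (simp_all only: nth_map)
qed

lemma traversal_subset:
  assumes "traversal G vs" "G \<subseteq> V \<times> V"
  shows "set vs \<subseteq> V"
proof
  fix v assume "v \<in> set vs"
  then obtain i where "i < length vs" "v = vs ! i"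
    by (auto simp: in_set_conv_nth)
  then have "(v, vs ! (Suc i mod length vs)) \<in> G \<union> G\<inverse>"
    using assms(1) by (simp add: traversal_def)
  then show "v \<in> V"
    using assms(2) by blast
qed

lemma circuit_edges_map: "circuit_edges (map h vs) = (`) h ` circuit_edges vs"
  unfolding circuit_edges_def image_image length_map
proof (rule image_cong[OF refl])
  fix i assume "i \<in> {..<length vs}"
  then show "{map h vs ! i, map h vs ! (Suc i mod length vs)} =
      h ` {vs ! i, vs ! (Suc i mod length vs)}"
    by (simp only: lessThan_iff circuit_step_map image_insert image_empty)
qed

lemma circuit_map:
  assumes inj: "inj_on h V" and G: "G \<subseteq> V \<times> V" and vs: "set vs \<subseteq> V"
  shows "traversal (map_prod h h ` G) (map h vs) \<longleftrightarrow> traversal G vs"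
    and "forward_arrows (map_prod h h ` G) (map h vs) = forward_arrows G vs"
proof -
  let ?H = "map_prod h h ` G"
  have arr: "(h u, h v) \<in> ?H \<longleftrightarrow> (u, v) \<in> G" if "u \<in> V" "v \<in> V" for u v
  proof
    assume "(h u, h v) \<in> ?H"
    then obtain u' v' where *: "(u', v') \<in> G" "h u = h u'" "h v = h v'"
      by auto
    then have "u' \<in> V" "v' \<in> V" using G by blast+
    then have "u = u'" "v = v'"
      using * inj_onD[OF inj] that by blast+
    then show "(u, v) \<in> G" using * by simp
  qed (auto intro: rev_image_eqI)
  have step: "(map h vs ! i, map h vs ! (Suc i mod length vs)) \<in> ?H \<longleftrightarrow>
        (vs ! i, vs ! (Suc i mod length vs)) \<in> G"
    and step': "(map h vs ! (Suc i mod length vs), map h vs ! i) \<in> ?H \<longleftrightarrow>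
        (vs ! (Suc i mod length vs), vs ! i) \<in> G" if "i < length vs" for i
    using circuit_step_in[OF that] vs
    unfolding circuit_step_map[OF that] by (simp_all only: arr subset_iff)
  show "forward_arrows ?H (map h vs) = forward_arrows G vs"
    unfolding forward_arrows_def length_map using step
    by (intro arg_cong[of _ _ card] Collect_cong conj_cong refl)
  have "distinct (map h vs) \<longleftrightarrow> distinct vs"
    using inj_on_subset[OF inj vs] by (simp add: distinct_map)
  then show "traversal ?H (map h vs) \<longleftrightarrow> traversal G vs"
    unfolding traversal_def length_map Un_iff converse_iff
    by (simp only: step step' cong: imp_cong)
qed

lemma signed_polygon_count_iso:
  fixes G :: "('v \<times> 'v) set" and h :: "'v \<Rightarrow> 'w"
  assumes inj: "inj_on h V" and G: "G \<subseteq> V \<times> V"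
  shows "signed_polygon_count (map_prod h h ` G) l = signed_polygon_count G l"
proof -
  let ?H = "map_prod h h ` G"
  let ?I = "(`) ((`) h) :: 'v set set \<Rightarrow> 'w set set"
  have H: "?H \<subseteq> h ` V \<times> h ` V"
    using G by auto
  have image: "{circuit_edges ws | ws. traversal ?H ws \<and> Q (length ws) (forward_arrows ?H ws)} =
      ?I ` {circuit_edges vs | vs. traversal G vs \<and> Q (length vs) (forward_arrows G vs)}"
    (is "?L = ?I ` ?R") for Q :: "nat \<Rightarrow> nat \<Rightarrow> bool"
  proof (intro equalityI subsetI)
    fix P assume "P \<in> ?L"
    then obtain ws where ws: "P = circuit_edges ws" "traversal ?H ws"
      "Q (length ws) (forward_arrows ?H ws)"
      by blast
    have "ws \<in> map h ` lists V"
      unfolding lists_image[symmetric] in_lists_conv_set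
      using traversal_subset[OF ws(2) H] by blast
    then obtain vs where vs: "ws = map h vs" "set vs \<subseteq> V"
      unfolding lists_eq_set by blast
    have "traversal G vs" "Q (length vs) (forward_arrows G vs)"
      using ws(2,3) unfolding vs(1) circuit_map[OF inj G vs(2)] length_map .
    moreover have "P = ?I (circuit_edges vs)"
      unfolding ws(1) vs(1) by (rule circuit_edges_map)
    ultimately show "P \<in> ?I ` ?R"
      by blast
  next
    fix P assume "P \<in> ?I ` ?R"
    then obtain vs where vs: "P = ?I (circuit_edges vs)" "traversal G vs"
      "Q (length vs) (forward_arrows G vs)"
      by blast
    have "P = circuit_edges (map h vs)" "traversal ?H (map h vs)"
      "Q (length (map h vs)) (forward_arrows ?H (map h vs))"
      unfolding circuit_edges_map circuit_map[OF inj G traversal_subset[OF vs(2) G]] length_map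
      by (fact vs)+
    then show "P \<in> ?L"
      by blast
  qed
  have poly: "polygons ?H l = ?I ` polygons G l"
    unfolding polygons_def by (rule image[of "\<lambda>n _. n = l"])
  have pos: "positive_polygons ?H l = ?I ` positive_polygons G l"
    unfolding positive_polygons_def by (rule image[of "\<lambda>n a. n = l \<and> even a"])
  have sub: "positive_polygons G l \<subseteq> polygons G l"
    unfolding positive_polygons_def polygons_def by blast
  have "polygons G l \<subseteq> Pow (Pow V)"
  proof
    fix P assume "P \<in> polygons G l"
    then obtain vs where vs: "P = circuit_edges vs" "traversal G vs"
      unfolding polygons_def by blast
    have "{vs ! i, vs ! (Suc i mod length vs)} \<subseteq> V" if "i < length vs" for i
      using circuit_step_in[OF that] traversal_subset[OF vs(2) G] by blast
    then show "P \<in> Pow (Pow V)"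
      unfolding vs(1) circuit_edges_def by blast
  qed
  then have injI: "inj_on ?I (polygons G l)"
    by (rule inj_on_subset[OF inj_on_image_Pow[OF inj_on_image_Pow[OF inj]]])
  have "?I ` polygons G l - ?I ` positive_polygons G l = ?I ` (polygons G l - positive_polygons G l)"
    by (rule inj_on_image_set_diff[OF injI _ sub, symmetric]) simp
  moreover have "card (?I ` (polygons G l - positive_polygons G l)) =
      card (polygons G l - positive_polygons G l)"
    by (intro card_image inj_on_subset[OF injI]) blast
  moreover have "card (?I ` positive_polygons G l) = card (positive_polygons G l)"
    by (intro card_image inj_on_subset[OF injI] sub)
  ultimately show ?thesis
    unfolding signed_polygon_count_def pos poly by simp
qed

lemma rotation_eq:
  assumes "x < m"
  shows "rotation m r x = (if x + r mod m < m then x + r mod m else x + r mod m - m)"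
proof -
  have "rotation m r x = (x + r mod m) mod m"
    by (simp add: rotation_def mod_simps)
  moreover have "r mod m < m"
    using assms by (intro mod_less_divisor) linarith
  then have "x + r mod m - m < m"
    using assms by linarith
  ultimately show ?thesis
    by (simp add: le_mod_geq)
qed

lemma inj_on_rotation: "inj_on (rotation m r) {..<m}"
proof (rule inj_onI)
  fix x y assume xy: "x \<in> {..<m}" "y \<in> {..<m}" "rotation m r x = rotation m r y"
  then have "r mod m < m" by auto
  then show "x = y" using xy by (auto simp: rotation_eq split: if_splits)
qed

lemma rotation_in_arc:
  assumes "x < m" "y < m" "z < m"
  shows "rotation m r y \<in> arc m (rotation m r x) (rotation m r z) \<longleftrightarrow> y \<in> arc m x z"
proof -
  define k where "k = r mod m"
  have k: "k < m" using assms by (auto simp: k_def)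
  have rot: "rotation m r u = (if u + k < m then u + k else u + k - m)" if "u < m" for u
    using that by (simp add: rotation_eq k_def)
  show ?thesis
    unfolding rot[OF assms(1)] rot[OF assms(2)] rot[OF assms(3)] arc_def
    using assms k
    by (cases "x + k < m"; cases "y + k < m"; cases "z + k < m"; cases "x < z"; simp; linarith)
qed

lemma signed_polygon_count_relocate:
  fixes \<pi> :: "nat \<Rightarrow> nat"
  assumes D: "chord_system D" and D': "chord_system D'" "D' = relocate \<pi> D"
    and inj: "inj_on \<pi> {..<2 * card D}"
    and arc: "\<And>x y z. x < 2 * card D \<Longrightarrow> y < 2 * card D \<Longrightarrow> z < 2 * card D \<Longrightarrow>
          \<pi> y \<in> arc (2 * card D) (\<pi> x) (\<pi> z) \<longleftrightarrow> y \<in> arc (2 * card D) x z"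
    and s: "chord_orientation D s" and s': "chord_orientation D' s'"
  shows "signed_polygon_count (directed_intersection_graph D' s') l =
         signed_polygon_count (directed_intersection_graph D s) l"
proof -
  let ?m = "2 * card D"
  let ?h = "(`) \<pi> :: nat set \<Rightarrow> nat set"
  have sub: "D \<subseteq> Pow {..<?m}"
    using chord_systemD(4)[OF D] by blast
  have injh: "inj_on ?h D"
    using inj_on_image_Pow[OF inj] sub inj_on_subset by blast
  have DD: "D' = ?h ` D"
    using D'(2) by (simp add: relocate_def)
  have card: "card D' = card D"
    unfolding DD by (rule card_image[OF injh])
  define t where "t = (\<lambda>C. \<pi> (s (inv_into D ?h C)))"
  have tC: "t (?h C) = \<pi> (s C)" if "C \<in> D" for C
    using that injh by (simp add: t_def)
  have t: "chord_orientation D' t"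
    using s tC unfolding DD chord_orientation_def by auto
  have sC: "s C \<in> C" "C = {s C, chord_end s C}" "chord_end s C \<noteq> s C"
      "s C < ?m" "chord_end s C < ?m" if "C \<in> D" for C
  proof -
    show "s C \<in> C" using that s by (simp add: chord_orientation_def)
    then show *: "C = {s C, chord_end s C}" "chord_end s C \<noteq> s C"
      using chord_end chord_systemD(3)[OF D that] by auto
    show "s C < ?m" "chord_end s C < ?m"
      using * chord_systemD(4)[OF D that] by blast+
  qed
  have tend: "chord_end t (?h C) = \<pi> (chord_end s C)" if "C \<in> D" for C
  proof -
    have "?h C \<in> D'" using that DD by blast
    then have "?h C = {t (?h C), chord_end t (?h C)}" "chord_end t (?h C) \<noteq> t (?h C)"
      using t chord_end chord_systemD(3)[OF D'(1)] by (auto simp: chord_orientation_def)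
    moreover have "?h C = {\<pi> (s C), \<pi> (chord_end s C)}"
      using sC(2)[OF that] by (metis image_empty image_insert)
    ultimately show ?thesis
      using tC[OF that] by (metis doubleton_eq_iff)
  qed
  have inter: "chords_intersect ?m (?h A) (?h B) \<longleftrightarrow> chords_intersect ?m A B"
    if "A \<in> D" "B \<in> D" for A B
  proof -
    have A: "?h A = {\<pi> (s A), \<pi> (chord_end s A)}" and B: "?h B = {\<pi> (s B), \<pi> (chord_end s B)}"
      using sC(2)[OF that(1)] sC(2)[OF that(2)] by (metis image_empty image_insert)+
    have "chords_intersect ?m (?h A) (?h B) \<longleftrightarrow>
       \<pi> (s B) \<in> arc ?m (\<pi> (s A)) (\<pi> (chord_end s A)) \<and>
         \<pi> (chord_end s B) \<in> arc ?m (\<pi> (chord_end s A)) (\<pi> (s A)) \<or>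
       \<pi> (chord_end s B) \<in> arc ?m (\<pi> (s A)) (\<pi> (chord_end s A)) \<and>
         \<pi> (s B) \<in> arc ?m (\<pi> (chord_end s A)) (\<pi> (s A))"
      by (rule chords_intersect_iff[OF A B])
    also have "\<dots> \<longleftrightarrow> chords_intersect ?m A B"
      unfolding chords_intersect_iff[OF sC(2)[OF that(1)] sC(2)[OF that(2)], of ?m]
      by (simp add: arc sC(4,5) that)
    finally show ?thesis .
  qed
  have "directed_intersection_graph D' t =
      map_prod ?h ?h ` directed_intersection_graph D s"
  proof -
    have arr: "(?h A, ?h B) \<in> directed_intersection_graph D' t \<longleftrightarrow>
        (A, B) \<in> directed_intersection_graph D s" if "A \<in> D" "B \<in> D" for A B
    proof -
      have "?h A \<in> D'" "?h B \<in> D'" using that DD by blast+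
      then show ?thesis
        unfolding directed_intersection_graph_def
        by (simp add: that card inter tC tend arc sC(4,5))
    qed
    have sub: "directed_intersection_graph D' t \<subseteq> (?h ` D) \<times> (?h ` D)"
        "directed_intersection_graph D s \<subseteq> D \<times> D"
      unfolding directed_intersection_graph_def DD by blast+
    show ?thesis
    proof (intro equalityI subsetI)
      fix p assume p: "p \<in> directed_intersection_graph D' t"
      then obtain A B where AB: "p = (?h A, ?h B)" "A \<in> D" "B \<in> D"
        using sub(1) by blast
      then have "(A, B) \<in> directed_intersection_graph D s"
        using p arr by blast
      then show "p \<in> map_prod ?h ?h ` directed_intersection_graph D s"
        unfolding AB(1) by (rule map_prod_imageI)
    next
      fix p assume "p \<in> map_prod ?h ?h ` directed_intersection_graph D s"
      then obtain A B where AB: "p = (?h A, ?h B)" "(A, B) \<in> directed_intersection_graph D s"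
        by auto
      then show "p \<in> directed_intersection_graph D' t"
        using arr sub(2) by blast
    qed
  qed
  then have "signed_polygon_count (directed_intersection_graph D' t) l =
      signed_polygon_count (directed_intersection_graph D s) l"
    using signed_polygon_count_iso[OF injh, of "directed_intersection_graph D s"]
    by (auto simp: directed_intersection_graph_def)
  then show ?thesis
    using signed_polygon_count_orientation[OF D'(1) t s'] by simp
qed

lemma chord_equiv_signed_polygon_count:
  assumes "chord_equiv D D'" "chord_orientation D s" "chord_orientation D' s'"
  shows "signed_polygon_count (directed_intersection_graph D s) l =
         signed_polygon_count (directed_intersection_graph D' s') l"
  using assms signed_polygon_count_relocate[OF _ _ _ inj_on_rotation rotation_in_arc, of D D']
  unfolding chord_equiv_def by metis


subsection \<open>The type of chord diagrams and the functions \<open>R\<^sub>k\<close>\<close>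

lemma part_equivp_chord_equiv: "part_equivp chord_equiv"
proof (rule part_equivpI)
  have "chord_equiv {} {}"
    by (auto simp: chord_equiv_def chord_system_def relocate_def partition_on_def)
  then show "\<exists>D. chord_equiv D D" ..
  have card: "card D' = card D" if "chord_equiv D D'" for D D'
  proof -
    have "D \<subseteq> Pow {..<2 * card D}"
      using that chord_systemD(4)[of D] unfolding chord_equiv_def by blast
    then have "inj_on ((`) (rotation (2 * card D) r)) D" for r
      using inj_on_image_Pow[OF inj_on_rotation] inj_on_subset by blast
    then show ?thesis
      using that by (auto simp: chord_equiv_def relocate_def card_image)
  qed
  have comp: "relocate (rotation m r') (relocate (rotation m r) D) = relocate (rotation m (r + r')) D"
    for m r r' D
    by (auto simp: relocate_def image_image rotation_def mod_simps add.assoc)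
  show "symp chord_equiv"
  proof (rule sympI)
    fix D D' assume *: "chord_equiv D D'"
    let ?m = "2 * card D"
    obtain r where r: "D' = relocate (rotation ?m r) D"
      using * by (auto simp: chord_equiv_def)
    have "relocate (rotation ?m (?m * r - r)) D' = relocate (rotation ?m (?m * r)) D"
    proof (cases "?m = 0")
      case True
      then have "\<Union>D = {}" "{} \<notin> D"
        using * chord_systemD(1)[of D] by (auto simp: chord_equiv_def chord_system_def)
      then have "D = {}"
        by (metis Union_empty_conv all_not_in_conv)
      then show ?thesis using r by (simp add: relocate_def)
    next
      case False
      then have "r + (?m * r - r) = ?m * r" by simp
      then show ?thesis unfolding r comp by simp
    qed
    also have "\<dots> = D"
      using * by (intro relocate_id) (auto simp: chord_equiv_def rotation_def)
    finally have "D = relocate (rotation (2 * card D') (?m * r - r)) D'"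
      by (simp add: card[OF *])
    then show "chord_equiv D' D"
      using * unfolding chord_equiv_def by blast
  qed
  show "transp chord_equiv"
  proof (rule transpI)
    fix D D' D'' assume *: "chord_equiv D D'" "chord_equiv D' D''"
    then obtain r r' where "D' = relocate (rotation (2 * card D) r) D"
      "D'' = relocate (rotation (2 * card D) r') D'"
      using card[OF *(1)] by (auto simp: chord_equiv_def)
    then have "D'' = relocate (rotation (2 * card D) (r + r')) D"
      using comp by simp
    then show "chord_equiv D D''"
      using * by (auto simp: chord_equiv_def)
  qed
qed

quotient_type chord_diagram = "nat set set" / partial: chord_equiv
  by (rule part_equivp_chord_equiv)

text \<open>The orientation of the chords is arbitrary by \<open>chord_equiv_signed_polygon_count\<close>.\<close>

definition R_system :: "nat \<Rightarrow> nat set set \<Rightarrow> int" where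
  "R_system k D = signed_polygon_count
     (directed_intersection_graph D (SOME s. chord_orientation D s)) (2 * k)"

lemma chord_orientation_some:
  assumes "chord_system D"
  shows "chord_orientation D (SOME s. chord_orientation D s)"
proof -
  have "C \<noteq> {}" if "C \<in> D" for C
    using chord_systemD(3)[OF assms that] by auto
  then have "chord_orientation D (\<lambda>C. SOME x. x \<in> C)"
    unfolding chord_orientation_def by (simp add: some_in_eq)
  then show ?thesis
    by (rule someI[of "chord_orientation D"])
qed

lift_definition R :: "nat \<Rightarrow> chord_diagram \<Rightarrow> int" is R_system
  unfolding R_system_def
  by (rule chord_equiv_signed_polygon_count) (auto simp: chord_equiv_def chord_orientation_some)

lemma R_abs_chord_diagram:
  assumes "chord_system D" "chord_orientation D s"
  shows "R k (abs_chord_diagram D) = signed_polygon_count (directed_intersection_graph D s) (2 * k)"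
proof -
  have "chord_equiv D D"
    unfolding chord_equiv_def
    using assms(1) relocate_id[of D "rotation (2 * card D) 0"]
    by (metis add_0_right mod_less rotation_def)
  then have "R k (abs_chord_diagram D) = R_system k D"
    by (rule R.abs_eq)
  also have "\<dots> = signed_polygon_count (directed_intersection_graph D s) (2 * k)"
    unfolding R_system_def
    using assms by (intro signed_polygon_count_orientation chord_orientation_some)
  finally show ?thesis .
qed


section \<open>The 4-term relation\<close>

text \<open>Every point of the circle \<open>{..<m}\<close> is an end of a chord, so "empty arc" means "no ends".\<close>

definition immediately_precedes :: "nat \<Rightarrow> nat \<Rightarrow> nat \<Rightarrow> bool" where
  "immediately_precedes m x y \<longleftrightarrow> x \<noteq> y \<and> arc m x y = {}"

text \<open>
  \<open>move_after m x y\<close> takes the point at position \<open>x\<close> out and puts it back immediately after the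
  point at position \<open>y\<close>; as the positions are always \<open>0, \<dots>, m - 1\<close>, the points which it passes
  (\<open>y\<close> included) move back by one position. Likewise for \<open>move_before\<close>.
\<close>

definition move_after :: "nat \<Rightarrow> nat \<Rightarrow> nat \<Rightarrow> nat \<Rightarrow> nat" where
  "move_after m x y z =
     (if z = x then y else if z = y \<or> z \<in> arc m x y then (z + m - 1) mod m else z)"

definition move_before :: "nat \<Rightarrow> nat \<Rightarrow> nat \<Rightarrow> nat \<Rightarrow> nat" where
  "move_before m x y z =
     (if z = x then y else if z = y \<or> z \<in> arc m y x then Suc z mod m else z)"

lemma move_after_correct:
  assumes "x < m" "y < m" "x \<noteq> y"
  shows "bij_betw (move_after m x y) {..<m} {..<m}"
    and "immediately_precedes m (move_after m x y y) (move_after m x y x)"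
    and "\<lbrakk>u < m; v < m; w < m; u \<noteq> x; v \<noteq> x; w \<noteq> x\<rbrakk> \<Longrightarrow>
      move_after m x y v \<in> arc m (move_after m x y u) (move_after m x y w) \<longleftrightarrow> v \<in> arc m u w"
proof -
  let ?f = "move_after m x y"
  have x: "?f x = y"
    by (simp add: move_after_def)
  have mv: "?f z = (if x < y then if x < z \<and> z \<le> y then z - 1 else z
      else if z = 0 then m - 1 else if x < z \<or> z \<le> y then z - 1 else z)"
    if "z < m" "z \<noteq> x" for z
  proof -
    have 1: "(z + m - 1) mod m = (if z = 0 then m - 1 else z - 1)"
      using that by (cases z) simp_all
    have 2: "z = y \<or> z \<in> arc m x y \<longleftrightarrow> (if x < y then x < z \<and> z \<le> y else x < z \<or> z \<le> y)"
      using assms that by (auto simp: arc_def)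
    show ?thesis
      unfolding move_after_def 1 2 using that assms by simp
  qed
  have lt: "?f z < m" if "z < m" "z \<noteq> x" for z
    unfolding mv[OF that] using that assms by (simp add: less_imp_diff_less)
  have less: "?f u < ?f w \<longleftrightarrow> (if x < y then u < w else u \<noteq> 0 \<and> (w = 0 \<or> u < w))"
    if "u < m" "w < m" "u \<noteq> x" "w \<noteq> x" for u w
    unfolding mv[OF that(1,3)] mv[OF that(2,4)] using that assms
    by (cases "x < y"; cases "u = 0"; cases "w = 0"; simp; linarith)
  have y: "?f z \<noteq> y" if "z < m" "z \<noteq> x" for z
    unfolding mv[OF that] using that assms by (cases "x < y"; cases "z = 0"; simp; linarith)
  have neq: "?f u \<noteq> ?f w" if "u < m" "w < m" "u \<noteq> w" for u w
  proof (cases "u = x \<or> w = x")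
    case True
    then show ?thesis using that x y by metis
  next
    case False
    have "?f u < ?f w \<or> ?f w < ?f u"
      using less[of u w] less[of w u] False that by (cases "x < y"; cases "u = 0"; cases "w = 0"; simp; linarith)
    then show ?thesis by linarith
  qed
  have "inj_on ?f {..<m}"
    using neq by (meson inj_onI lessThan_iff)
  moreover have "?f ` {..<m} \<subseteq> {..<m}"
    using x lt assms(2) by (metis image_subsetI lessThan_iff)
  ultimately show "bij_betw ?f {..<m} {..<m}"
    by (simp add: bij_betw_def endo_inj_surj)
  show "immediately_precedes m (?f y) (?f x)"
    unfolding x mv[OF assms(2) assms(3)[symmetric]] immediately_precedes_def arc_def
    using assms by auto
  show "?f v \<in> arc m (?f u) (?f w) \<longleftrightarrow> v \<in> arc m u w"
    if "u < m" "v < m" "w < m" "u \<noteq> x" "v \<noteq> x" "w \<noteq> x"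
  proof -
    have "?f v \<in> arc m (?f u) (?f w) \<longleftrightarrow>
        (if ?f u < ?f w then ?f u < ?f v \<and> ?f v < ?f w else ?f u < ?f v \<or> ?f v < ?f w)"
      using lt[OF that(2,5)] by (simp add: arc_def)
    also have "\<dots> \<longleftrightarrow> (if u < w then u < v \<and> v < w else u < v \<or> v < w)"
      unfolding less[OF that(1,3,4,6)] less[OF that(1,2,4,5)] less[OF that(2,3,5,6)]
      by (cases "x < y"; cases "u = 0"; cases "v = 0"; cases "w = 0"; simp; linarith?)
    also have "\<dots> \<longleftrightarrow> v \<in> arc m u w"
      using that(2) by (simp add: arc_def)
    finally show ?thesis .
  qed
qed

lemma move_before_correct:
  assumes "x < m" "y < m" "x \<noteq> y"
  shows "bij_betw (move_before m x y) {..<m} {..<m}"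
    and "immediately_precedes m (move_before m x y x) (move_before m x y y)"
    and "\<lbrakk>u < m; v < m; w < m; u \<noteq> x; v \<noteq> x; w \<noteq> x\<rbrakk> \<Longrightarrow>
      move_before m x y v \<in> arc m (move_before m x y u) (move_before m x y w) \<longleftrightarrow> v \<in> arc m u w"
proof -
  let ?f = "move_before m x y"
  have x: "?f x = y"
    by (simp add: move_before_def)
  have mv: "?f z = (if y < x then if y \<le> z \<and> z < x then Suc z else z
      else if Suc z = m then 0 else if y \<le> z \<or> z < x then Suc z else z)"
    if "z < m" "z \<noteq> x" for z
  proof -
    have 1: "Suc z mod m = (if Suc z = m then 0 else Suc z)"
      using that by (simp add: mod_Suc)
    have 2: "z = y \<or> z \<in> arc m y x \<longleftrightarrow> (if y < x then y \<le> z \<and> z < x else y \<le> z \<or> z < x)"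
      using assms that by (auto simp: arc_def)
    show ?thesis
      unfolding move_before_def 1 2 using that assms by simp
  qed
  have lt: "?f z < m" if "z < m" "z \<noteq> x" for z
    unfolding mv[OF that] using that assms by simp
  have less: "?f u < ?f w \<longleftrightarrow> (if y < x then u < w else Suc w \<noteq> m \<and> (Suc u = m \<or> u < w))"
    if "u < m" "w < m" "u \<noteq> x" "w \<noteq> x" for u w
    unfolding mv[OF that(1,3)] mv[OF that(2,4)] using that assms
    by (cases "y < x"; cases "Suc u = m"; cases "Suc w = m"; simp; linarith)
  have y: "?f z \<noteq> y" if "z < m" "z \<noteq> x" for z
    unfolding mv[OF that] using that assms by (cases "y < x"; cases "Suc z = m"; simp; linarith)
  have neq: "?f u \<noteq> ?f w" if "u < m" "w < m" "u \<noteq> w" for u w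
  proof (cases "u = x \<or> w = x")
    case True
    then show ?thesis using that x y by metis
  next
    case False
    have "?f u < ?f w \<or> ?f w < ?f u"
      using less[of u w] less[of w u] False that by (cases "u < w") simp_all
    then show ?thesis by linarith
  qed
  have "inj_on ?f {..<m}"
    using neq by (meson inj_onI lessThan_iff)
  moreover have "?f ` {..<m} \<subseteq> {..<m}"
    using x lt assms(2) by (metis image_subsetI lessThan_iff)
  ultimately show "bij_betw ?f {..<m} {..<m}"
    by (simp add: bij_betw_def endo_inj_surj)
  show "immediately_precedes m (?f x) (?f y)"
    unfolding x mv[OF assms(2) assms(3)[symmetric]] immediately_precedes_def arc_def
    using assms by auto
  show "?f v \<in> arc m (?f u) (?f w) \<longleftrightarrow> v \<in> arc m u w"
    if "u < m" "v < m" "w < m" "u \<noteq> x" "v \<noteq> x" "w \<noteq> x"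
  proof -
    have "?f v \<in> arc m (?f u) (?f w) \<longleftrightarrow>
        (if ?f u < ?f w then ?f u < ?f v \<and> ?f v < ?f w else ?f u < ?f v \<or> ?f v < ?f w)"
      using lt[OF that(2,5)] by (simp add: arc_def)
    also have "\<dots> \<longleftrightarrow> (if u < w then u < v \<and> v < w else u < v \<or> v < w)"
      unfolding less[OF that(1,3,4,6)] less[OF that(1,2,4,5)] less[OF that(2,3,5,6)]
      using that(1-3)
      by (cases "y < x"; cases "Suc u = m"; cases "Suc v = m"; cases "Suc w = m"; simp; linarith?)
    also have "\<dots> \<longleftrightarrow> v \<in> arc m u w"
      using that(2) by (simp add: arc_def)
    finally show ?thesis .
  qed
qed

text \<open>
  Below, \<open>a\<close> is an end of a chord \<open>A\<close>, and \<open>b1\<close>, \<open>b2\<close> are the ends of another chord \<open>B\<close>, where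
  \<open>a\<close> and \<open>b1\<close> are neighbors. After the relocation \<open>\<pi> = move_along m a b1 b2\<close>, the ends \<open>a\<close> and
  \<open>b2\<close> are the neighboring points \<open>\<pi> a\<close> and \<open>\<pi> b2\<close>.
\<close>

definition exchange_ends :: "nat \<Rightarrow> nat \<Rightarrow> nat set set \<Rightarrow> nat set set" where
  "exchange_ends x y D = relocate (transpose x y) D"

definition move_along :: "nat \<Rightarrow> nat \<Rightarrow> nat \<Rightarrow> nat \<Rightarrow> nat \<Rightarrow> nat" where
  "move_along m a b1 b2 =
     (if immediately_precedes m a b1 then move_after m a b2 else move_before m a b2)"

definition weight_system :: "(chord_diagram \<Rightarrow> 'a::ab_group_add) \<Rightarrow> bool" where
  "weight_system f \<longleftrightarrow>
     (\<forall>D A B a b1 b2. chord_system D \<longrightarrow> A \<in> D \<longrightarrow> B \<in> D \<longrightarrow> A \<noteq> B \<longrightarrow> a \<in> A \<longrightarrow> B = {b1, b2} \<longrightarrow>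
        immediately_precedes (2 * card D) a b1 \<or> immediately_precedes (2 * card D) b1 a \<longrightarrow>
        (let \<pi> = move_along (2 * card D) a b1 b2;
             D\<^sub>1 = exchange_ends a b1 D;
             D\<^sub>2 = relocate \<pi> D;
             D\<^sub>3 = exchange_ends (\<pi> a) (\<pi> b2) D\<^sub>2
         in f (abs_chord_diagram D) - f (abs_chord_diagram D\<^sub>1) =
            f (abs_chord_diagram D\<^sub>2) - f (abs_chord_diagram D\<^sub>3)))"

lemma chord_system_relocate:
  assumes "chord_system D" "bij_betw \<pi> {..<2 * card D} {..<2 * card D}"
  shows "chord_system (relocate \<pi> D)" "card (relocate \<pi> D) = card D"
proof -
  have inj: "inj_on \<pi> {..<2 * card D}" using assms(2) by (simp add: bij_betw_def)
  have sub: "D \<subseteq> Pow {..<2 * card D}"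
    using chord_systemD(4)[OF assms(1)] by blast
  then have "inj_on ((`) \<pi>) D"
    using inj_on_image_Pow[OF inj] inj_on_subset by blast
  then show card: "card (relocate \<pi> D) = card D"
    by (simp add: relocate_def card_image)
  have "\<pi> ` {..<2 * card D} = {..<2 * card D}"
    using assms(2) by (simp add: bij_betw_def)
  then have "\<Union>(relocate \<pi> D) = {..<2 * card D}"
    unfolding relocate_def image_Union[symmetric] chord_systemD(1)[OF assms(1)] .
  moreover have "disjoint (relocate \<pi> D)"
    unfolding relocate_def
    by (rule disjoint_image[OF _ chord_systemD(2)[OF assms(1)]])
      (simp add: chord_systemD(1)[OF assms(1)] inj)
  moreover have "{} \<notin> relocate \<pi> D"
    using assms(1) by (auto simp: relocate_def chord_system_def partition_on_def)
  moreover have "card (\<pi> ` C) = 2" if "C \<in> D" for C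
  proof -
    have "inj_on \<pi> C" using that sub inj inj_on_subset by blast
    then show ?thesis using chord_systemD(3)[OF assms(1) that] by (simp add: card_image)
  qed
  ultimately show "chord_system (relocate \<pi> D)"
    unfolding chord_system_def card partition_on_def by (auto simp: relocate_def)
qed

end

theory Submission
  imports Defs "HOL-Library.Multiset"
begin

text \<open>
  Orient the chords and record the directed intersection graph by its skew-symmetric matrix
  \<open>m\<close> of signs (\<open>arrow_sign\<close>). The sign of a polygon of even length is the product of the entries
  of \<open>m\<close> along any traversal, and a list of distinct chords that is not a traversal has product
  \<open>0\<close>, so that signed numbers of polygons become sums over all such lists.

  Exchanging the neighboring ends \<open>a\<close> and \<open>b1\<close> affects only the entry at \<open>A\<close> and \<open>B\<close>. Polygons
  that avoid the edge \<open>{A, B}\<close> therefore cancel in the difference of \<open>R\<^sub>k\<close> on the two sides, and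
  each of the others has exactly one traversal of the form \<open>A, B, \<dots>\<close>. Hence the difference is the
  change of the entry \<open>m A B\<close>, times the sum \<open>P\<close> of the products along all simple paths from \<open>B\<close>
  to \<open>A\<close> with \<open>2 * k - 2\<close> inner vertices (\<open>signed_polygon_count_change_edge\<close>).

  Moving \<open>a\<close> along \<open>B\<close> is a row operation: the entry \<open>m X A\<close> becomes \<open>m X A - m X B\<close> for every
  other chord \<open>X\<close>. All other entries persist, and the exchange of neighboring ends
  changes the entry at \<open>A\<close> and \<open>B\<close> by the same amount before and after the move. So the 4-term
  relation holds if the row operation does not change \<open>P\<close>. It changes \<open>P\<close> by the sum of the
  products along closed paths from \<open>B\<close> to \<open>B\<close> with \<open>2 * k - 2\<close> inner vertices. Such a path has an
  odd number of steps, so by skew symmetry its reversal has the opposite product, and the sum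
  vanishes (\<open>path_sum_closed\<close>).

  The four diagrams of the relation live on different sets of chords. Their graphs are pulled back
  to the chords of the first one along the relocation of the points (\<open>relocated_digraph\<close>), and the
  entries of the matrices are then compared by looking at which triples of ends are in cyclic order.
\<close>

section \<open>Products of signs along paths and circuits\<close>

definition arrow_sign :: "('v \<times> 'v) set \<Rightarrow> 'v \<Rightarrow> 'v \<Rightarrow> int" where
  "arrow_sign G u v = of_bool ((v, u) \<in> G) - of_bool ((u, v) \<in> G)"

lemma arrow_sign_swap: "arrow_sign G v u = - arrow_sign G u v"
  by (simp add: arrow_sign_def)

definition path_weight :: "('v \<Rightarrow> 'v \<Rightarrow> int) \<Rightarrow> 'v \<Rightarrow> 'v list \<Rightarrow> 'v \<Rightarrow> int" where
  "path_weight m x ws y = prod_list (map2 m (x # ws) (ws @ [y]))"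

lemma path_weight_Cons: "path_weight m x (z # ws) y = m x z * path_weight m z ws y"
  by (simp add: path_weight_def)

lemma path_weight_snoc: "path_weight m x (ws @ [z]) y = path_weight m x ws z * m z y"
proof -
  have "zip (x # ws @ [z]) ((ws @ [z]) @ [y]) = zip (x # ws) (ws @ [z]) @ [(z, y)]"
    using zip_append[of "x # ws" "ws @ [z]" "[z]" "[y]"] by simp
  then show ?thesis
    by (simp add: path_weight_def del: zip_Cons_Cons)
qed

lemma path_weight_cong:
  assumes "\<And>u v. u \<in> insert x (set ws) \<Longrightarrow> v \<in> insert y (set ws) \<Longrightarrow> m u v = m' u v"
  shows "path_weight m x ws y = path_weight m' x ws y"
proof -
  have "map2 m (x # ws) (ws @ [y]) = map2 m' (x # ws) (ws @ [y])"
  proof (rule map_cong[OF refl], clarify)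
    fix u v assume "(u, v) \<in> set (zip (x # ws) (ws @ [y]))"
    then have "u \<in> set (x # ws)" "v \<in> set (ws @ [y])"
      by (rule set_zip_leftD, rule set_zip_rightD)
    then show "m u v = m' u v" using assms by auto
  qed
  then show ?thesis unfolding path_weight_def by (rule arg_cong)
qed

lemma prod_list_uminus:
  fixes f :: "'a \<Rightarrow> 'b \<Rightarrow> int"
  shows "prod_list (map (\<lambda>(u, v). - f u v) ps) = (-1) ^ length ps * prod_list (map (case_prod f) ps)"
  by (induction ps) auto

text \<open>
  Each of the \<open>Suc (length ws)\<close> steps contributes one factor \<open>-1\<close>.
\<close>
lemma path_weight_reverse:
  assumes "\<And>u v. m v u = - m u v"
  shows "path_weight m y (rev ws) x = (-1) ^ Suc (length ws) * path_weight m x ws y"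
proof -
  have "zip (y # rev ws) (rev ws @ [x]) = rev (zip (ws @ [y]) (x # ws))"
    by (subst zip_rev[symmetric]) simp_all
  also have "zip (ws @ [y]) (x # ws) = map prod.swap (zip (x # ws) (ws @ [y]))"
    by (subst zip_commute) (simp add: prod.swap_def case_prod_unfold)
  finally have "path_weight m y (rev ws) x =
      prod_list (rev (map (\<lambda>(u, v). m v u) (zip (x # ws) (ws @ [y]))))"
    by (simp add: path_weight_def rev_map[symmetric] comp_def case_prod_unfold del: zip_Cons_Cons zip_append)
  also have "\<dots> = prod_list (map (\<lambda>(u, v). - m u v) (zip (x # ws) (ws @ [y])))"
    by (simp add: assms[symmetric])
  also have "\<dots> = (-1) ^ length (zip (x # ws) (ws @ [y])) * path_weight m x ws y"
    unfolding path_weight_def by (rule prod_list_uminus)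
  finally show ?thesis by simp
qed

text \<open>
  The vertices, edges and the product of signs of a circuit depend only on its multiset of steps,
  which makes the invariance under rotation immediate.
\<close>
definition circuit_steps :: "'v list \<Rightarrow> ('v \<times> 'v) list" where
  "circuit_steps vs = zip vs (rotate1 vs)"

definition circuit_weight :: "('v \<Rightarrow> 'v \<Rightarrow> int) \<Rightarrow> 'v list \<Rightarrow> int" where
  "circuit_weight m vs = prod_list (map (case_prod m) (circuit_steps vs))"

lemma circuit_weight_Cons: "circuit_weight m (x # ws) = path_weight m x ws x"
  by (simp add: circuit_weight_def circuit_steps_def path_weight_def)

lemma length_circuit_steps [simp]: "length (circuit_steps vs) = length vs"
  by (simp add: circuit_steps_def)

lemma nth_circuit_steps:
  "i < length vs \<Longrightarrow> circuit_steps vs ! i = (vs ! i, vs ! (Suc i mod length vs))"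
  by (simp add: circuit_steps_def nth_rotate1)

lemma circuit_edges_steps: "circuit_edges vs = (\<lambda>(u, v). {u, v}) ` set (circuit_steps vs)"
  by (force simp: circuit_edges_def set_conv_nth nth_circuit_steps)

lemma traversal_steps:
  "traversal G vs \<longleftrightarrow> distinct vs \<and> set (circuit_steps vs) \<subseteq> G \<union> G\<inverse>"
  by (force simp: traversal_def set_conv_nth nth_circuit_steps)

lemma circuit_steps_rotate1: "circuit_steps (rotate1 vs) = rotate1 (circuit_steps vs)"
proof (rule nth_equalityI)
  fix i assume "i < length (circuit_steps (rotate1 vs))"
  then have i: "i < length vs" by simp
  then have "Suc i mod length vs < length vs" by (intro mod_less_divisor) linarith
  then show "circuit_steps (rotate1 vs) ! i = rotate1 (circuit_steps vs) ! i"
    using i by (simp add: nth_circuit_steps nth_rotate1)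
qed simp

lemma mset_rotate1 [simp]: "mset (rotate1 xs) = mset xs"
  by (cases xs) simp_all

lemma mset_circuit_steps_rotate: "mset (circuit_steps (rotate n vs)) = mset (circuit_steps vs)"
  by (induction n) (simp_all add: circuit_steps_rotate1)

text \<open>
  Keeping the first vertex in place makes the list of steps of the reversed circuit exactly the
  reversed list of reversed steps, without a further rotation.
\<close>
lemma circuit_steps_reverse:
  "circuit_steps (v # rev us) = rev (map prod.swap (circuit_steps (v # us)))"
proof -
  have "circuit_steps (v # rev us) = rev (zip (us @ [v]) (v # us))"
    unfolding circuit_steps_def by (subst zip_rev[symmetric]) simp_all
  also have "zip (us @ [v]) (v # us) = map prod.swap (circuit_steps (v # us))"
    unfolding circuit_steps_def by (subst zip_commute) (simp add: prod.swap_def case_prod_unfold)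
  finally show ?thesis .
qed

lemma circuit_cong:
  assumes "mset (circuit_steps us) = mset (circuit_steps vs)" "distinct us \<longleftrightarrow> distinct vs"
  shows "traversal G us \<longleftrightarrow> traversal G vs" "circuit_edges us = circuit_edges vs"
    "circuit_weight m us = circuit_weight m vs"
  using assms mset_eq_setD[OF assms(1)]
  by (simp_all add: traversal_steps circuit_edges_steps circuit_weight_def mset_map flip: prod_mset_prod_list)

lemma circuit_reverse:
  assumes "\<And>u v. m v u = - m u v" "even (length (v # us))"
  shows "traversal G (v # rev us) \<longleftrightarrow> traversal G (v # us)"
    "circuit_edges (v # rev us) = circuit_edges (v # us)"
    "circuit_weight m (v # rev us) = circuit_weight m (v # us)"
proof -
  show "traversal G (v # rev us) \<longleftrightarrow> traversal G (v # us)"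
    unfolding traversal_steps circuit_steps_reverse by auto
  show "circuit_edges (v # rev us) = circuit_edges (v # us)"
    unfolding circuit_edges_steps circuit_steps_reverse
    by (auto simp: image_image insert_commute case_prod_unfold)
  show "circuit_weight m (v # rev us) = circuit_weight m (v # us)"
    using assms(2) by (simp add: circuit_weight_Cons path_weight_reverse[OF assms(1)])
qed

lemma circuit_start_at_step:
  assumes "(x, y) \<in> set (circuit_steps vs)" "x \<noteq> y"
  obtains n ws where "rotate n vs = x # y # ws"
proof -
  obtain n where n: "n < length vs" "vs ! n = x" "vs ! (Suc n mod length vs) = y"
    using assms(1) by (auto simp: in_set_conv_nth nth_circuit_steps)
  have "length vs \<noteq> 1"
    using n assms(2) by auto
  then have "length (rotate n vs) \<ge> 2"
    using n(1) by simp
  moreover have "vs \<noteq> []"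
    using n(1) by auto
  then have "rotate n vs ! 0 = x" "rotate n vs ! Suc 0 = y"
    using calculation n nth_rotate[of 0 vs n] nth_rotate[of "Suc 0" vs n] by simp_all
  ultimately have "\<exists>ws. rotate n vs = x # y # ws"
    by (cases "rotate n vs"; cases "tl (rotate n vs)") auto
  then show ?thesis using that by blast
qed

text \<open>
  A rotation moves any step to the front; if the edge is passed in the wrong direction, the circuit is
  reversed first. Reversal preserves the product of signs because the length is even.
\<close>
lemma circuit_start_at_edge:
  assumes "{x, y} \<in> circuit_edges vs" "x \<noteq> y" "even (length vs)" "\<And>u v. m v u = - m u v"
  obtains ws where "length (x # y # ws) = length vs"
    "traversal G (x # y # ws) \<longleftrightarrow> traversal G vs"
    "circuit_edges (x # y # ws) = circuit_edges vs"
    "circuit_weight m (x # y # ws) = circuit_weight m vs"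
proof -
  have start: "\<exists>ws. length (x # y # ws) = length us \<and>
      (traversal G (x # y # ws) \<longleftrightarrow> traversal G us) \<and>
      circuit_edges (x # y # ws) = circuit_edges us \<and>
      circuit_weight m (x # y # ws) = circuit_weight m us"
    if step: "(x, y) \<in> set (circuit_steps us)" for us
  proof -
    obtain n ws where ws: "rotate n us = x # y # ws"
      using circuit_start_at_step[OF step assms(2)] .
    have "length (x # y # ws) = length us"
      using arg_cong[OF ws, of length] by simp
    then show ?thesis
      using circuit_cong[OF mset_circuit_steps_rotate[of n us]] unfolding ws
      by (metis distinct_rotate ws)
  qed
  have "(x, y) \<in> set (circuit_steps vs) \<or> (y, x) \<in> set (circuit_steps vs)"
    using assms(1) by (auto simp: circuit_edges_steps doubleton_eq_iff)
  then have "\<exists>ws. length (x # y # ws) = length vs \<and>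
      (traversal G (x # y # ws) \<longleftrightarrow> traversal G vs) \<and>
      circuit_edges (x # y # ws) = circuit_edges vs \<and>
      circuit_weight m (x # y # ws) = circuit_weight m vs"
  proof
    assume yx: "(y, x) \<in> set (circuit_steps vs)"
    then obtain v us where vs: "vs = v # us"
      by (cases vs) (auto simp: circuit_steps_def)
    have "(x, y) \<in> set (circuit_steps (v # rev us))"
      using yx by (force simp: circuit_steps_reverse vs)
    then show ?thesis
      using start[of "v # rev us"] assms(3) unfolding vs
      by (simp only: circuit_reverse[OF assms(4)] length_Cons length_rev)
  qed (rule start)
  then show ?thesis using that by blast
qed

text \<open>
  Every vertex of a circuit lies on only two of its edges. As one of them leads back to the preceding
  vertex, the other one determines the next vertex, starting from the two given ones.
\<close>
lemma circuit_determined_by_edges: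
  assumes "circuit_edges (x # y # us) = circuit_edges (x # y # ws)"
    and "length us = length ws" "distinct (x # y # us)" "distinct (x # y # ws)"
  shows "us = ws"
proof -
  let ?p = "x # y # us" and ?q = "x # y # ws"
  let ?l = "length ?q"
  have "?p ! i = ?q ! i \<and> ?p ! Suc i = ?q ! Suc i" if "Suc i < ?l" for i
    using that
  proof (induction i)
    case (Suc i)
    then have IH: "?p ! i = ?q ! i" "?p ! Suc i = ?q ! Suc i" by simp_all
    have "{?p ! Suc i, ?p ! Suc (Suc i)} \<in> circuit_edges ?p"
      unfolding circuit_edges_def using Suc.prems assms(2)
      by (intro image_eqI[of _ _ "Suc i"]) simp_all
    then obtain j where j: "j < ?l"
      "{?p ! Suc i, ?p ! Suc (Suc i)} = {?q ! j, ?q ! (Suc j mod ?l)}"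
      unfolding assms(1) unfolding circuit_edges_def by blast
    have lt: "Suc j mod ?l < ?l" by (rule mod_less_divisor) simp
    have "?p ! Suc (Suc i) \<noteq> ?p ! i"
      using Suc.prems assms(2,3) by (subst nth_eq_iff_index_eq) simp_all
    then have 1: "?p ! Suc (Suc i) \<noteq> ?q ! i" unfolding IH .
    have "?q ! Suc i = ?q ! j \<and> ?p ! Suc (Suc i) = ?q ! (Suc j mod ?l) \<or>
        ?q ! Suc i = ?q ! (Suc j mod ?l) \<and> ?p ! Suc (Suc i) = ?q ! j"
      using j(2) unfolding IH doubleton_eq_iff by blast
    then have "Suc i = j \<and> ?p ! Suc (Suc i) = ?q ! (Suc j mod ?l) \<or>
        Suc i = Suc j mod ?l \<and> ?p ! Suc (Suc i) = ?q ! j"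
      using nth_eq_iff_index_eq[OF assms(4)] Suc.prems lt j(1) by (metis Suc_lessD)
    moreover have "j = i" if "Suc i = Suc j mod ?l"
      using that j(1) by (cases "Suc j = ?l") simp_all
    ultimately have "Suc i = j \<and> ?p ! Suc (Suc i) = ?q ! (Suc j mod ?l)"
      using 1 by blast
    then show ?case using IH Suc.prems by auto
  qed simp
  then have "?p ! i = ?q ! i" if "i < ?l" for i
    using that by (cases i) (auto simp: nth_Cons')
  then have "?p = ?q"
    using assms(2) by (intro nth_equalityI) simp_all
  then show ?thesis by simp
qed

lemma circuit_weight_traversal:
  assumes "asym G" "traversal G vs"
  shows "circuit_weight (arrow_sign G) vs = (-1) ^ forward_arrows G vs"
proof -
  have "circuit_weight (arrow_sign G) vs =
      (\<Prod>i<length vs. arrow_sign G (vs ! i) (vs ! (Suc i mod length vs)))"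
    unfolding circuit_weight_def prod.list_conv_set_nth
    by (intro prod.cong) (auto simp: nth_circuit_steps atLeast0LessThan)
  also have "\<dots> = (\<Prod>i<length vs. if (vs ! i, vs ! (Suc i mod length vs)) \<in> G then -1 else 1)"
    using assms by (intro prod.cong) (auto simp: traversal_def arrow_sign_def asym_on_def)
  finally show ?thesis
    by (simp only: minus_one_power_forward_arrows)
qed

text \<open>
  This allows sums over traversals to be extended to all lists of distinct vertices, an index set that
  does not depend on the graph.
\<close>
lemma circuit_weight_not_traversal:
  assumes "distinct vs" "\<not> traversal G vs"
  shows "circuit_weight (arrow_sign G) vs = 0"
proof -
  obtain u v where "(u, v) \<in> set (circuit_steps vs)" "(u, v) \<notin> G \<union> G\<inverse>"
    using assms by (auto simp: traversal_steps)
  then have "0 \<in> set (map (case_prod (arrow_sign G)) (circuit_steps vs))"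
    by (force simp: arrow_sign_def)
  then show ?thesis
    unfolding circuit_weight_def by (simp only: prod_list_zero_iff)
qed

section \<open>Sums over simple paths\<close>

definition simple_lists :: "'v set \<Rightarrow> nat \<Rightarrow> 'v list set" where
  "simple_lists V n = {ws. distinct ws \<and> set ws \<subseteq> V \<and> length ws = n}"

definition path_sum :: "('v \<Rightarrow> 'v \<Rightarrow> int) \<Rightarrow> 'v set \<Rightarrow> nat \<Rightarrow> 'v \<Rightarrow> 'v \<Rightarrow> int" where
  "path_sum m V n x y = (\<Sum>ws\<in>simple_lists V n. path_weight m x ws y)"

lemma finite_simple_lists: "finite V \<Longrightarrow> finite (simple_lists V n)"
  unfolding simple_lists_def by (rule finite_subset[OF _ finite_lists_length_eq[of V n]]) auto

lemma path_sum_reverse: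
  assumes "\<And>u v. m v u = - m u v"
  shows "path_sum m V n y x = (-1) ^ Suc n * path_sum m V n x y"
proof -
  have "bij_betw rev (simple_lists V n) (simple_lists V n)"
    by (rule bij_betw_byWitness[of _ rev]) (auto simp: simple_lists_def)
  then have "path_sum m V n y x = (\<Sum>ws\<in>simple_lists V n. path_weight m y (rev ws) x)"
    unfolding path_sum_def by (rule sum.reindex_bij_betw[symmetric])
  also have "\<dots> = (\<Sum>ws\<in>simple_lists V n. (-1) ^ Suc n * path_weight m x ws y)"
    by (intro sum.cong) (simp_all add: path_weight_reverse[OF assms] simple_lists_def)
  finally show ?thesis
    by (simp only: path_sum_def sum_distrib_left)
qed

text \<open>
  Reversal permutes the closed paths at \<open>x\<close> and changes the sign of each product, as the number
  \<open>n + 1\<close> of steps is odd.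
\<close>
lemma path_sum_closed:
  assumes "\<And>u v. m v u = - m u v" "even n"
  shows "path_sum m V n x x = 0"
  using path_sum_reverse[where m = m and V = V and n = n and x = x and y = x, OF assms(1)] assms(2) by simp

text \<open>
  Only the last step of a path enters \<open>y\<close>, so the sum is linear in the entries \<open>m u y\<close>. As \<open>n > 0\<close>,
  this last step starts at an inner vertex, and no entry between the end points \<open>x\<close> and \<open>y\<close> occurs.
\<close>
lemma path_sum_slide:
  assumes "n > 0" "\<And>u v. u \<in> insert x V \<Longrightarrow> v \<in> V \<Longrightarrow> m' u v = m u v"
    and "\<And>u. u \<in> V \<Longrightarrow> m' u y = m u y - c * m u z"
  shows "path_sum m' V n x y = path_sum m V n x y - c * path_sum m V n x z"
proof -
  have "path_weight m' x ws y = path_weight m x ws y - c * path_weight m x ws z"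
    if "ws \<in> simple_lists V n" for ws
  proof -
    have "ws \<noteq> []"
      using that assms(1) by (auto simp: simple_lists_def)
    then obtain us u where ws: "ws = us @ [u]"
      by (metis rev_exhaust)
    then have V: "set us \<subseteq> V" "u \<in> V"
      using that by (auto simp: simple_lists_def)
    have "path_weight m' x us u = path_weight m x us u"
      using V by (intro path_weight_cong assms(2)) auto
    then show ?thesis
      by (simp add: ws path_weight_snoc assms(3)[OF V(2)] right_diff_distrib mult.left_commute)
  qed
  then show ?thesis
    by (simp add: path_sum_def sum_subtractf sum_distrib_left)
qed

section \<open>Changing one edge of a directed graph\<close>

lemma finite_polygons:
  assumes "finite V" "G \<subseteq> V \<times> V"
  shows "finite (polygons G l)"
proof (rule finite_subset)
  show "polygons G l \<subseteq> circuit_edges ` {vs. set vs \<subseteq> V \<and> length vs = l}"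
    using traversal_subset[OF _ assms(2)] unfolding polygons_def by blast
  show "finite (circuit_edges ` {vs. set vs \<subseteq> V \<and> length vs = l})"
    using assms(1) by (intro finite_imageI finite_lists_length_eq)
qed

definition polygon_sign :: "('v \<times> 'v) set \<Rightarrow> nat \<Rightarrow> 'v set set \<Rightarrow> int" where
  "polygon_sign G l P = (if P \<in> positive_polygons G l then 1 else -1)"

lemma signed_polygon_count_eq_sum:
  assumes "finite (polygons G l)"
  shows "signed_polygon_count G l = (\<Sum>P\<in>polygons G l. polygon_sign G l P)"
proof -
  have "positive_polygons G l \<subseteq> polygons G l"
    unfolding positive_polygons_def polygons_def by blast
  then show ?thesis
    using assms unfolding polygon_sign_def signed_polygon_count_def
    by (simp add: sum.If_cases Int_absorb1 Diff_eq[symmetric])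
qed

text \<open>
  The polygons through \<open>{x, y}\<close> correspond bijectively to their traversals that start with \<open>x, y\<close>:
  these exist by \<open>circuit_start_at_edge\<close> and are unique by \<open>circuit_determined_by_edges\<close>.
\<close>
lemma sum_polygons_through_edge:
  assumes V: "finite V" "G \<subseteq> V \<times> V" and G: "asym G" and xy: "x \<in> V" "y \<in> V" "x \<noteq> y" and n: "even n"
  shows "(\<Sum>P\<in>{P \<in> polygons G (n + 2). {x, y} \<in> P}. polygon_sign G (n + 2) P) =
    arrow_sign G x y * path_sum (arrow_sign G) (V - {x, y}) n y x"
proof -
  let ?W = "simple_lists (V - {x, y}) n"
  let ?T = "{ws \<in> ?W. traversal G (x # y # ws)}"
  let ?m = "arrow_sign G"
  have skew: "?m v u = - ?m u v" for u v by (rule arrow_sign_swap)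
  have T: "ws \<in> ?T \<longleftrightarrow> traversal G (x # y # ws) \<and> length ws = n" for ws
  proof
    assume *: "traversal G (x # y # ws) \<and> length ws = n"
    then have "set (x # y # ws) \<subseteq> V" "distinct (x # y # ws)"
      using traversal_subset[OF _ V(2)] by (blast, simp add: traversal_def)
    then show "ws \<in> ?T" using * by (auto simp: simple_lists_def)
  qed (auto simp: simple_lists_def)
  have dist: "distinct (x # y # ws)" if "ws \<in> ?W" for ws
    using that xy(3) by (auto simp: simple_lists_def)
  have inj: "inj_on (\<lambda>ws. circuit_edges (x # y # ws)) ?W"
  proof (rule inj_onI)
    fix us ws assume "us \<in> ?W" "ws \<in> ?W" "circuit_edges (x # y # us) = circuit_edges (x # y # ws)"
    then show "us = ws"
      using dist by (intro circuit_determined_by_edges) (simp_all add: simple_lists_def)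
  qed
  have normal: "\<exists>ws\<in>?T. circuit_edges vs = circuit_edges (x # y # ws) \<and>
      circuit_weight ?m vs = circuit_weight ?m (x # y # ws)"
    if vs: "traversal G vs" "length vs = n + 2" "{x, y} \<in> circuit_edges vs" for vs
  proof -
    have "even (length vs)" using vs(2) n by simp
    then obtain ws where ws: "length (x # y # ws) = length vs"
      "traversal G (x # y # ws) \<longleftrightarrow> traversal G vs"
      "circuit_edges (x # y # ws) = circuit_edges vs"
      "circuit_weight ?m (x # y # ws) = circuit_weight ?m vs"
      by (rule circuit_start_at_edge[where m = ?m and G = G, OF vs(3) xy(3) _ skew])
    then have "ws \<in> ?T" unfolding T using vs by simp
    then show ?thesis
      using ws(3,4)[symmetric] by blast
  qed
  have image: "{P \<in> polygons G (n + 2). {x, y} \<in> P} = (\<lambda>ws. circuit_edges (x # y # ws)) ` ?T"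
  proof (intro equalityI subsetI)
    fix P assume "P \<in> {P \<in> polygons G (n + 2). {x, y} \<in> P}"
    then obtain vs where "P = circuit_edges vs" "traversal G vs" "length vs = n + 2" "{x, y} \<in> P"
      unfolding polygons_def by blast
    then show "P \<in> (\<lambda>ws. circuit_edges (x # y # ws)) ` ?T"
      using normal by blast
  next
    fix P assume "P \<in> (\<lambda>ws. circuit_edges (x # y # ws)) ` ?T"
    then obtain ws where ws: "P = circuit_edges (x # y # ws)" "traversal G (x # y # ws)" "length ws = n"
      using T by blast
    then have "P \<in> polygons G (n + 2)"
      unfolding polygons_def by force
    moreover have "{x, y} \<in> P"
      unfolding ws circuit_edges_def by (intro image_eqI[of _ _ 0]) simp_all
    ultimately show "P \<in> {P \<in> polygons G (n + 2). {x, y} \<in> P}" by simp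
  qed
  have sign: "polygon_sign G (n + 2) (circuit_edges (x # y # ws)) = circuit_weight ?m (x # y # ws)"
    if ws: "ws \<in> ?T" for ws
  proof -
    have wt: "circuit_weight ?m (x # y # ws) = (-1) ^ forward_arrows G (x # y # ws)"
      using ws by (intro circuit_weight_traversal G) simp
    have "circuit_edges (x # y # ws) \<in> positive_polygons G (n + 2) \<longleftrightarrow>
        even (forward_arrows G (x # y # ws))"
    proof
      assume "circuit_edges (x # y # ws) \<in> positive_polygons G (n + 2)"
      then obtain vs where vs: "circuit_edges vs = circuit_edges (x # y # ws)" "traversal G vs"
        "length vs = n + 2" "even (forward_arrows G vs)"
        unfolding positive_polygons_def by force
      have "{x, y} \<in> circuit_edges vs"
        using image ws unfolding vs(1) by blast
      then obtain us where us: "us \<in> ?T" "circuit_edges vs = circuit_edges (x # y # us)"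
        "circuit_weight ?m vs = circuit_weight ?m (x # y # us)"
        using normal vs by blast
      have "us = ws"
        using inj_onD[OF inj, of us ws] us ws vs(1) by simp
      then have "(-1) ^ forward_arrows G (x # y # ws) = (1::int)"
        using us(3) wt circuit_weight_traversal[OF G vs(2)] vs(4) by simp
      then show "even (forward_arrows G (x # y # ws))"
        by (simp add: minus_one_power_iff split: if_splits)
    next
      assume "even (forward_arrows G (x # y # ws))"
      then show "circuit_edges (x # y # ws) \<in> positive_polygons G (n + 2)"
        using ws unfolding positive_polygons_def T by force
    qed
    then show ?thesis
      unfolding wt polygon_sign_def by (simp add: minus_one_power_iff)
  qed
  have "(\<Sum>P\<in>{P \<in> polygons G (n + 2). {x, y} \<in> P}. polygon_sign G (n + 2) P) =
      (\<Sum>ws\<in>?T. polygon_sign G (n + 2) (circuit_edges (x # y # ws)))"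
    unfolding image by (intro sum.reindex[unfolded comp_def] inj_on_subset[OF inj]) blast
  also have "\<dots> = (\<Sum>ws\<in>?T. circuit_weight ?m (x # y # ws))"
    using sign by (rule sum.cong[OF refl])
  also have "\<dots> = (\<Sum>ws\<in>?W. circuit_weight ?m (x # y # ws))"
    using V(1) dist
    by (intro sum.mono_neutral_left finite_simple_lists ballI circuit_weight_not_traversal) auto
  also have "\<dots> = ?m x y * path_sum ?m (V - {x, y}) n y x"
    by (simp add: circuit_weight_Cons path_weight_Cons path_sum_def sum_distrib_left)
  finally show ?thesis .
qed

lemma signed_polygon_count_delete_edge:
  assumes "finite V" "G \<subseteq> V \<times> V" "asym G" "x \<in> V" "y \<in> V" "x \<noteq> y" "even n"
  shows "signed_polygon_count G (n + 2) - signed_polygon_count (G - {(x, y), (y, x)}) (n + 2) =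
    arrow_sign G x y * path_sum (arrow_sign G) (V - {x, y}) n y x"
proof -
  let ?H = "G - {(x, y), (y, x)}" and ?l = "n + 2"
  have edge: "{u, v} \<in> circuit_edges vs \<longleftrightarrow> (u, v) \<in> set (circuit_steps vs) \<or> (v, u) \<in> set (circuit_steps vs)"
    for u v and vs :: "'a list"
    by (force simp: circuit_edges_steps doubleton_eq_iff)
  have trav: "traversal ?H vs \<longleftrightarrow> traversal G vs \<and> {x, y} \<notin> circuit_edges vs" for vs
    unfolding traversal_steps edge by blast
  have forw: "forward_arrows ?H vs = forward_arrows G vs" if "{x, y} \<notin> circuit_edges vs" for vs
  proof -
    have "{vs ! i, vs ! (Suc i mod length vs)} \<noteq> {x, y}" if "i < length vs" for i
      using that \<open>{x, y} \<notin> circuit_edges vs\<close> unfolding circuit_edges_def by auto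
    then show ?thesis
      unfolding forward_arrows_def doubleton_eq_iff by (intro arg_cong[of _ _ card]) auto
  qed
  have poly: "polygons ?H ?l = {P \<in> polygons G ?l. {x, y} \<notin> P}"
    unfolding polygons_def trav by blast
  have pos: "P \<in> positive_polygons ?H ?l \<longleftrightarrow> P \<in> positive_polygons G ?l" if "{x, y} \<notin> P" for P
    unfolding positive_polygons_def trav mem_Collect_eq using forw that by (intro iff_exI) auto
  have fin: "finite (polygons G ?l)"
    using assms(1,2) by (rule finite_polygons)
  then have "signed_polygon_count ?H ?l = (\<Sum>P\<in>polygons ?H ?l. polygon_sign ?H ?l P)"
    by (intro signed_polygon_count_eq_sum finite_subset[OF _ fin]) (unfold poly, blast)
  also have "\<dots> = (\<Sum>P\<in>{P \<in> polygons G ?l. {x, y} \<notin> P}. polygon_sign G ?l P)"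
    unfolding poly by (intro sum.cong refl) (simp only: polygon_sign_def pos mem_Collect_eq not_False_eq_True)
  finally have "signed_polygon_count G ?l - signed_polygon_count ?H ?l =
      (\<Sum>P\<in>polygons G ?l - {P \<in> polygons G ?l. {x, y} \<notin> P}. polygon_sign G ?l P)"
    using fin by (simp add: signed_polygon_count_eq_sum sum_diff)
  also have "polygons G ?l - {P \<in> polygons G ?l. {x, y} \<notin> P} = {P \<in> polygons G ?l. {x, y} \<in> P}"
    by blast
  finally show ?thesis
    using sum_polygons_through_edge[OF assms] by simp
qed

text \<open>
  Deleting the edge \<open>{x, y}\<close> from \<open>G\<close> and from \<open>H\<close> gives the same graph, and the path sum never
  uses that edge.
\<close>
lemma signed_polygon_count_change_edge:
  assumes V: "finite V" "G \<subseteq> V \<times> V" "H \<subseteq> V \<times> V" and asym: "asym G" "asym H"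
    and xy: "x \<in> V" "y \<in> V" "x \<noteq> y" and n: "even n" "n > 0"
    and agree: "\<And>u v. u \<in> V \<Longrightarrow> v \<in> V \<Longrightarrow> {u, v} \<noteq> {x, y} \<Longrightarrow> arrow_sign H u v = arrow_sign G u v"
  shows "signed_polygon_count G (n + 2) - signed_polygon_count H (n + 2) =
    (arrow_sign G x y - arrow_sign H x y) * path_sum (arrow_sign G) (V - {x, y}) n y x"
proof -
  have arrow: "(u, v) \<in> K \<longleftrightarrow> arrow_sign K u v = -1" if "asym K" for K :: "('a \<times> 'a) set" and u v
    using that by (auto simp: arrow_sign_def asym_on_def)
  have "(u, v) \<in> G - {(x, y), (y, x)} \<longleftrightarrow> (u, v) \<in> H - {(x, y), (y, x)}" for u v
  proof (cases "u \<in> V \<and> v \<in> V \<and> {u, v} \<noteq> {x, y}")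
    case True
    then show ?thesis using agree[of u v] by (auto simp: arrow[OF asym(1)] arrow[OF asym(2)])
  next
    case False
    then show ?thesis using V(2,3) by (auto simp: doubleton_eq_iff)
  qed
  then have eq: "G - {(x, y), (y, x)} = H - {(x, y), (y, x)}" by auto
  have "path_sum (arrow_sign H) (V - {x, y}) n y x = path_sum (arrow_sign G) (V - {x, y}) n y x"
    using path_sum_slide[OF n(2), where x = y and V = "V - {x, y}" and y = x and c = 0
        and m = "arrow_sign G" and m' = "arrow_sign H"] agree xy
    by (auto simp: doubleton_eq_iff)
  then show ?thesis
    using signed_polygon_count_delete_edge[OF V(1,2) asym(1) xy n(1)]
      signed_polygon_count_delete_edge[OF V(1,3) asym(2) xy n(1)]
    by (simp add: eq algebra_simps)
qed

text \<open>
  The 4-term relation for abstract directed graphs: \<open>change\<close> and \<open>jump\<close> describe the exchange of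
  neighboring ends, \<open>slide\<close> describes moving an end of the chord \<open>x\<close> along the chord \<open>y\<close>.
\<close>
lemma four_term_digraphs:
  assumes V: "finite V" "x \<in> V" "y \<in> V" "x \<noteq> y" and n: "even n" "n > 0"
    and sub: "G\<^sub>0 \<subseteq> V \<times> V" "G\<^sub>1 \<subseteq> V \<times> V" "G\<^sub>2 \<subseteq> V \<times> V" "G\<^sub>3 \<subseteq> V \<times> V"
    and asym: "asym G\<^sub>0" "asym G\<^sub>1" "asym G\<^sub>2" "asym G\<^sub>3"
    and change: "\<And>u v. u \<in> V \<Longrightarrow> v \<in> V \<Longrightarrow> {u, v} \<noteq> {x, y} \<Longrightarrow> arrow_sign G\<^sub>1 u v = arrow_sign G\<^sub>0 u v"
      "\<And>u v. u \<in> V \<Longrightarrow> v \<in> V \<Longrightarrow> {u, v} \<noteq> {x, y} \<Longrightarrow> arrow_sign G\<^sub>3 u v = arrow_sign G\<^sub>2 u v"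
    and slide: "\<And>u v. u \<in> V - {x} \<Longrightarrow> v \<in> V - {x} \<Longrightarrow> arrow_sign G\<^sub>2 u v = arrow_sign G\<^sub>0 u v"
      "\<And>u. u \<in> V - {x, y} \<Longrightarrow> arrow_sign G\<^sub>2 u x = arrow_sign G\<^sub>0 u x - arrow_sign G\<^sub>0 u y"
    and jump: "arrow_sign G\<^sub>0 x y - arrow_sign G\<^sub>1 x y = arrow_sign G\<^sub>2 x y - arrow_sign G\<^sub>3 x y"
  shows "signed_polygon_count G\<^sub>0 (n + 2) - signed_polygon_count G\<^sub>1 (n + 2) =
    signed_polygon_count G\<^sub>2 (n + 2) - signed_polygon_count G\<^sub>3 (n + 2)"
proof -
  have "path_sum (arrow_sign G\<^sub>2) (V - {x, y}) n y x =
      path_sum (arrow_sign G\<^sub>0) (V - {x, y}) n y x - 1 * path_sum (arrow_sign G\<^sub>0) (V - {x, y}) n y y"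
    using V by (intro path_sum_slide n(2)) (auto simp: slide)
  also have "path_sum (arrow_sign G\<^sub>0) (V - {x, y}) n y y = 0"
    using n(1) arrow_sign_swap by (intro path_sum_closed)
  finally have "path_sum (arrow_sign G\<^sub>2) (V - {x, y}) n y x =
      path_sum (arrow_sign G\<^sub>0) (V - {x, y}) n y x"
    by simp
  moreover have "signed_polygon_count G\<^sub>0 (n + 2) - signed_polygon_count G\<^sub>1 (n + 2) =
      (arrow_sign G\<^sub>0 x y - arrow_sign G\<^sub>1 x y) * path_sum (arrow_sign G\<^sub>0) (V - {x, y}) n y x"
    using change(1)
    by (rule signed_polygon_count_change_edge[OF V(1) sub(1,2) asym(1,2) V(2-4) n])
  moreover have "signed_polygon_count G\<^sub>2 (n + 2) - signed_polygon_count G\<^sub>3 (n + 2) =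
      (arrow_sign G\<^sub>2 x y - arrow_sign G\<^sub>3 x y) * path_sum (arrow_sign G\<^sub>2) (V - {x, y}) n y x"
    using change(2)
    by (rule signed_polygon_count_change_edge[OF V(1) sub(3,4) asym(3,4) V(2-4) n])
  ultimately show ?thesis
    by (simp only: jump)
qed

section \<open>The cyclic order of the points\<close>

lemma immediately_precedes_iff:
  assumes "u < m" "v < m"
  shows "immediately_precedes m u v \<longleftrightarrow> u \<noteq> v \<and> (v = Suc u \<or> v = 0 \<and> Suc u = m)"
proof -
  have "{u<..<v} = {} \<longleftrightarrow> v \<le> Suc u"
    by (metis Suc_leI atLeastSucLessThan_greaterThanLessThan atLeastLessThan_empty_iff not_le)
  moreover have "{u<..<m} = {} \<longleftrightarrow> m \<le> Suc u"
    by (metis Suc_leI atLeastSucLessThan_greaterThanLessThan atLeastLessThan_empty_iff not_le)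
  moreover have "{..<v} = {} \<longleftrightarrow> v = 0"
    by (cases v) auto
  ultimately show ?thesis
    using assms by (auto simp: immediately_precedes_def arc_def)
qed

definition neighbours :: "nat \<Rightarrow> nat \<Rightarrow> nat \<Rightarrow> bool" where
  "neighbours m u v \<longleftrightarrow> immediately_precedes m u v \<or> immediately_precedes m v u"

lemma arc_swap:
  assumes "x < m" "y < m" "z < m" "x \<noteq> y" "y \<noteq> z" "x \<noteq> z"
  shows "x \<in> arc m y z \<longleftrightarrow> y \<notin> arc m x z" "z \<in> arc m x y \<longleftrightarrow> y \<notin> arc m x z"
  using assms by (auto simp: mem_arc_iff)

lemma arc_reverse:
  assumes "x \<noteq> y" "z \<noteq> x" "z \<noteq> y" "z < m"
  shows "z \<in> arc m x y \<longleftrightarrow> z \<notin> arc m y x"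
  using assms by (auto simp: mem_arc_iff)

text \<open>
  No point lies between neighbors, so they are interchangeable relative to all other points. The three
  parts differ only in the place that the neighbors take in the cyclic order; \<open>arc_swap\<close> reduces
  the last two to the first.
\<close>
lemma neighbours_replace_arc:
  assumes "neighbours m u v" "u < m" "v < m" "x < m" "z < m" "x \<noteq> z" "x \<notin> {u, v}" "z \<notin> {u, v}"
  shows "u \<in> arc m x z \<longleftrightarrow> v \<in> arc m x z" "x \<in> arc m u z \<longleftrightarrow> x \<in> arc m v z" "x \<in> arc m z u \<longleftrightarrow> x \<in> arc m z v"
proof -
  have *: "u \<in> arc m x z \<longleftrightarrow> v \<in> arc m x z"
    if "x < m" "z < m" "x \<noteq> z" "x \<notin> {u, v}" "z \<notin> {u, v}" for x z
    using that assms(1-3) by (auto simp: neighbours_def immediately_precedes_iff mem_arc_iff)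
  show "u \<in> arc m x z \<longleftrightarrow> v \<in> arc m x z"
    using assms by (intro *)
  show "x \<in> arc m u z \<longleftrightarrow> x \<in> arc m v z"
    using *[of x z] arc_swap(1)[of x m u z] arc_swap(1)[of x m v z] assms by auto
  show "x \<in> arc m z u \<longleftrightarrow> x \<in> arc m z v"
    using *[of z x] arc_swap(2)[of z m u x] arc_swap(2)[of z m v x] assms by auto
qed

lemma transpose_neighbours_arc:
  assumes uv: "neighbours m u v" "u < m" "v < m"
    and xyz: "x < m" "y < m" "z < m" "x \<noteq> y" "y \<noteq> z" "x \<noteq> z" and not: "\<not> {u, v} \<subseteq> {x, y, z}"
  shows "transpose u v y \<in> arc m (transpose u v x) (transpose u v z) \<longleftrightarrow> y \<in> arc m x z"
proof -
  have *: "transpose u v y \<in> arc m (transpose u v x) (transpose u v z) \<longleftrightarrow> y \<in> arc m x z"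
    if uv: "neighbours m u v" "u < m" "v < m" "v \<notin> {x, y, z}" for u v
  proof -
    have tr: "transpose u v w = (if w = u then v else w)" if "w \<in> {x, y, z}" for w
      using that uv(4) by (auto simp: transpose_def)
    consider "u = x" | "u = y" | "u = z" | "u \<notin> {x, y, z}" by blast
    then show ?thesis
    proof cases
      case 1
      then show ?thesis using neighbours_replace_arc(2)[OF uv(1-3), of y z] uv(4) xyz by (simp add: tr)
    next
      case 2
      then show ?thesis using neighbours_replace_arc(1)[OF uv(1-3), of x z] uv(4) xyz by (simp add: tr)
    next
      case 3
      then show ?thesis using neighbours_replace_arc(3)[OF uv(1-3), of y x] uv(4) xyz by (simp add: tr)
    next
      case 4
      then show ?thesis by (simp add: tr)
    qed
  qed
  show ?thesis
  proof (cases "v \<in> {x, y, z}")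
    case True
    then have "u \<notin> {x, y, z}" using not by blast
    moreover have "neighbours m v u" using uv(1) by (auto simp: neighbours_def)
    ultimately show ?thesis
      using *[of v u] uv by (simp add: transpose_commute)
  qed (rule *[OF uv])
qed

section \<open>The move along a chord\<close>

text \<open>
  The side of the chord \<open>{b1, b2}\<close> on which \<open>a\<close> lies is preserved: \<open>a\<close> follows \<open>b2\<close> after the move exactly if
  it preceded \<open>b1\<close> before, and in both positions it lies outside the arc from \<open>b1\<close> to \<open>b2\<close>;
  in the other case it lies inside both times.
\<close>
lemma move_along_correct:
  assumes lt: "a < m" "b1 < m" "b2 < m" and ne: "a \<noteq> b1" "a \<noteq> b2" "b1 \<noteq> b2"
    and nb: "neighbours m a b1"
  defines "\<pi> \<equiv> move_along m a b1 b2"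
  shows "bij_betw \<pi> {..<m} {..<m}" "neighbours m (\<pi> a) (\<pi> b2)"
    "\<pi> a \<in> arc m (\<pi> b1) (\<pi> b2) \<longleftrightarrow> a \<in> arc m b1 b2"
    "\<And>x y z. \<lbrakk>x < m; y < m; z < m; a \<notin> {x, y, z}\<rbrakk> \<Longrightarrow> \<pi> y \<in> arc m (\<pi> x) (\<pi> z) \<longleftrightarrow> y \<in> arc m x z"
proof -
  have \<pi>: "bij_betw \<pi> {..<m} {..<m} \<and> neighbours m (\<pi> a) (\<pi> b2) \<and>
     (\<forall>x y z. x < m \<and> y < m \<and> z < m \<and> a \<notin> {x, y, z} \<longrightarrow>
        (\<pi> y \<in> arc m (\<pi> x) (\<pi> z) \<longleftrightarrow> y \<in> arc m x z)) \<and>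
     (if immediately_precedes m a b1 then immediately_precedes m (\<pi> b2) (\<pi> a)
      else immediately_precedes m (\<pi> a) (\<pi> b2))"
  proof (cases "immediately_precedes m a b1")
    case True
    then have "\<pi> = move_after m a b2" by (simp add: \<pi>_def move_along_def fun_eq_iff)
    then show ?thesis
      using True move_after_correct[OF lt(1,3) ne(2)] by (simp add: neighbours_def)
  next
    case False
    then have "\<pi> = move_before m a b2" by (simp add: \<pi>_def move_along_def fun_eq_iff)
    then show ?thesis
      using False move_before_correct[OF lt(1,3) ne(2)] by (simp add: neighbours_def)
  qed
  then show bij: "bij_betw \<pi> {..<m} {..<m}" and "neighbours m (\<pi> a) (\<pi> b2)"
    and "\<And>x y z. \<lbrakk>x < m; y < m; z < m; a \<notin> {x, y, z}\<rbrakk> \<Longrightarrow> \<pi> y \<in> arc m (\<pi> x) (\<pi> z) \<longleftrightarrow> y \<in> arc m x z"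
    by blast+
  have dir: "if immediately_precedes m a b1 then immediately_precedes m (\<pi> b2) (\<pi> a)
      else immediately_precedes m (\<pi> a) (\<pi> b2)"
    using \<pi> by blast
  have lt': "\<pi> a < m" "\<pi> b1 < m" "\<pi> b2 < m"
    using bij_betwE[OF bij] lt by auto
  have ne': "\<pi> a \<noteq> \<pi> b1" "\<pi> a \<noteq> \<pi> b2" "\<pi> b1 \<noteq> \<pi> b2"
    using bij_betw_imp_inj_on[OF bij] lt ne by (simp_all add: inj_on_eq_iff)
  show "\<pi> a \<in> arc m (\<pi> b1) (\<pi> b2) \<longleftrightarrow> a \<in> arc m b1 b2"
  proof (cases "immediately_precedes m a b1")
    case True
    then have "b2 \<notin> arc m a b1" "\<pi> b1 \<notin> arc m (\<pi> b2) (\<pi> a)"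
      using dir by (simp_all add: immediately_precedes_def)
    then have "a \<notin> arc m b1 b2" "\<pi> a \<notin> arc m (\<pi> b1) (\<pi> b2)"
      using arc_swap[of b1 m a b2] arc_swap[of a m b1 b2] arc_swap[of "\<pi> b2" m "\<pi> b1" "\<pi> a"] arc_swap[of "\<pi> b1" m "\<pi> a" "\<pi> b2"] arc_reverse[of b1 b2 a m]
        arc_reverse[of "\<pi> b1" "\<pi> b2" "\<pi> a" m] lt ne lt' ne' by metis+
    then show ?thesis by simp
  next
    case False
    then have "immediately_precedes m b1 a" "immediately_precedes m (\<pi> a) (\<pi> b2)"
      using dir nb by (simp_all add: neighbours_def)
    then have "b2 \<notin> arc m b1 a" "\<pi> b1 \<notin> arc m (\<pi> a) (\<pi> b2)"
      by (simp_all add: immediately_precedes_def)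
    then have "a \<in> arc m b1 b2" "\<pi> a \<in> arc m (\<pi> b1) (\<pi> b2)"
      using arc_swap(2)[of b1 m a b2] arc_swap(1)[of "\<pi> b1" m "\<pi> a" "\<pi> b2"] lt ne lt' ne' by metis+
    then show ?thesis by simp
  qed
qed

section \<open>The sign matrix of a chord diagram\<close>

text \<open>
  Two chords intersect exactly if one end of \<open>Y\<close>, but not the other, lies on the arc from the
  beginning to the end of \<open>X\<close>. The difference of the two indicators is thus \<open>0\<close> for chords that do
  not intersect, and otherwise tells the direction of the arrow.
\<close>
lemma arrow_sign_chords:
  assumes D: "chord_system D" and s: "chord_orientation D s" and XY: "X \<in> D" "Y \<in> D" "X \<noteq> Y"
  defines "m \<equiv> 2 * card D"
  shows "arrow_sign (directed_intersection_graph D s) X Y =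
    of_bool (chord_end s Y \<in> arc m (s X) (chord_end s X)) - of_bool (s Y \<in> arc m (s X) (chord_end s X))"
proof -
  have X: "X = {s X, chord_end s X}" "chord_end s X \<noteq> s X"
    and Y: "Y = {s Y, chord_end s Y}" "chord_end s Y \<noteq> s Y"
    using s XY chord_end chord_systemD(3)[OF D] by (auto simp: chord_orientation_def)
  have lt: "s X < m" "chord_end s X < m" "s Y < m" "chord_end s Y < m"
    using X(1) Y(1) chord_systemD(4)[OF D] XY unfolding m_def by blast+
  have "X \<inter> Y = {}"
    using chord_systemD(2)[OF D] XY by (auto simp: disjoint_def)
  then have ne: "s X \<noteq> s Y" "chord_end s X \<noteq> s Y" "s X \<noteq> chord_end s Y" "chord_end s X \<noteq> chord_end s Y"
    using X(1) Y(1) by blast+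
  have "z \<in> arc m (chord_end s X) (s X) \<longleftrightarrow> z \<notin> arc m (s X) (chord_end s X)"
    if "z = s Y \<or> z = chord_end s Y" for z
    using arc_reverse[of "chord_end s X" "s X" z m] that lt ne X(2) by metis
  then have inter: "chords_intersect m X Y \<longleftrightarrow>
      (s Y \<in> arc m (s X) (chord_end s X)) \<noteq> (chord_end s Y \<in> arc m (s X) (chord_end s X))"
    unfolding chords_intersect_iff[OF X(1) Y(1)] by blast
  have "(X, Y) \<in> directed_intersection_graph D s \<longleftrightarrow>
      chords_intersect m X Y \<and> s Y \<in> arc m (s X) (chord_end s X)"
    using XY by (simp add: directed_intersection_graph_def m_def)
  moreover have "(Y, X) \<in> directed_intersection_graph D s \<longleftrightarrow>
      chords_intersect m X Y \<and> s Y \<notin> arc m (s X) (chord_end s X)"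
    using arrow_iff_not_reverse[OF D s XY(1,2)] calculation chords_intersect_sym[OF D XY(2,1)]
    unfolding m_def directed_intersection_graph_def by blast
  ultimately show ?thesis
    unfolding arrow_sign_def inter by auto
qed

lemma asym_directed_intersection_graph:
  assumes "chord_system D" "chord_orientation D s"
  shows "asym (directed_intersection_graph D s)"
proof (rule asymI)
  fix X Y assume "(X, Y) \<in> directed_intersection_graph D s"
  moreover from this have "X \<in> D" "Y \<in> D" "chords_intersect (2 * card D) X Y"
    by (auto simp: directed_intersection_graph_def)
  ultimately show "(Y, X) \<notin> directed_intersection_graph D s"
    using arrow_iff_not_reverse[OF assms] by blast
qed

text \<open>
  The intersection number of the oriented chords from \<open>p x\<close> to \<open>p x'\<close> and from \<open>p y\<close> to \<open>p y'\<close>.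
\<close>
definition crossing_sign :: "nat \<Rightarrow> (nat \<Rightarrow> nat) \<Rightarrow> nat \<Rightarrow> nat \<Rightarrow> nat \<Rightarrow> nat \<Rightarrow> int" where
  "crossing_sign m p x x' y y' =
     of_bool (p y' \<in> arc m (p x) (p x')) - of_bool (p y \<in> arc m (p x) (p x'))"

text \<open>
  The chords of \<open>relocate p D\<close> are oriented by transporting \<open>s\<close> along \<open>p\<close>; the graph \<open>G\<close> is the
  resulting one, with each chord \<open>p ` C\<close> renamed to \<open>C\<close>.
\<close>
lemma relocated_digraph:
  assumes D: "chord_system D" and s: "chord_orientation D s"
    and p: "bij_betw p {..<2 * card D} {..<2 * card D}"
  defines "m \<equiv> 2 * card D"
  obtains G where "G \<subseteq> D \<times> D" "asym G"
    "R k (abs_chord_diagram (relocate p D)) = signed_polygon_count G (2 * k)"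
    "\<And>X Y. X \<in> D \<Longrightarrow> Y \<in> D \<Longrightarrow> X \<noteq> Y \<Longrightarrow>
      arrow_sign G X Y = crossing_sign m p (s X) (chord_end s X) (s Y) (chord_end s Y)"
proof -
  let ?h = "(`) p"
  let ?D' = "relocate p D"
  have inj_p: "inj_on p {..<m}"
    using p by (simp add: bij_betw_def m_def)
  have "D \<subseteq> Pow {..<m}"
    using chord_systemD(4)[OF D] by (auto simp: m_def)
  then have inj: "inj_on ?h D"
    using inj_on_image_Pow[OF inj_p] inj_on_subset by blast
  define t where "t = (\<lambda>C. p (s (inv_into D ?h C)))"
  have t: "t (?h C) = p (s C)" if "C \<in> D" for C
    using that inj by (simp add: t_def)
  have D': "chord_system ?D'" "2 * card ?D' = m"
    using chord_system_relocate[OF D p] by (simp_all add: m_def)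
  have ori: "chord_orientation ?D' t"
    using s t by (auto simp: chord_orientation_def relocate_def)
  have t_end: "chord_end t (?h C) = p (chord_end s C)" if "C \<in> D" for C
  proof -
    have C: "C = {s C, chord_end s C}"
      using s that chord_end chord_systemD(3)[OF D] by (auto simp: chord_orientation_def)
    have "?h C \<in> ?D'" using that by (simp add: relocate_def)
    then have "?h C = {t (?h C), chord_end t (?h C)}" "chord_end t (?h C) \<noteq> t (?h C)"
      using ori chord_end chord_systemD(3)[OF D'(1)] by (auto simp: chord_orientation_def)
    moreover have "?h C = {p (s C), p (chord_end s C)}"
      using C by (metis image_empty image_insert)
    ultimately show ?thesis
      using t[OF that] by (metis doubleton_eq_iff)
  qed
  let ?G' = "directed_intersection_graph ?D' t"
  define G where "G = {(X, Y). X \<in> D \<and> Y \<in> D \<and> (?h X, ?h Y) \<in> ?G'}"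
  have G: "G \<subseteq> D \<times> D"
    by (auto simp: G_def)
  have "?G' \<subseteq> ?h ` D \<times> ?h ` D"
    unfolding directed_intersection_graph_def relocate_def by blast
  then have "?G' = map_prod ?h ?h ` G"
    by (force simp: G_def)
  then have "signed_polygon_count ?G' (2 * k) = signed_polygon_count G (2 * k)"
    using signed_polygon_count_iso[OF inj G] by simp
  then have R: "R k (abs_chord_diagram ?D') = signed_polygon_count G (2 * k)"
    using R_abs_chord_diagram[OF D'(1) ori] by simp
  have asym: "asym G"
    using asym_directed_intersection_graph[OF D'(1) ori] unfolding G_def asym_on_def by blast
  have sign: "arrow_sign G X Y = crossing_sign m p (s X) (chord_end s X) (s Y) (chord_end s Y)"
    if XY: "X \<in> D" "Y \<in> D" "X \<noteq> Y" for X Y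
  proof -
    have XY': "?h X \<in> ?D'" "?h Y \<in> ?D'"
      using XY by (simp_all add: relocate_def)
    have "?h X \<noteq> ?h Y"
      using inj_onD[OF inj _ XY(1,2)] XY(3) by blast
    from arrow_sign_chords[OF D'(1) ori XY' this]
    have "arrow_sign ?G' (?h X) (?h Y) =
        of_bool (p (chord_end s Y) \<in> arc m (p (s X)) (p (chord_end s X))) -
        of_bool (p (s Y) \<in> arc m (p (s X)) (p (chord_end s X)))"
      unfolding D'(2) t[OF XY(1)] t[OF XY(2)] t_end[OF XY(1)] t_end[OF XY(2)] .
    then show ?thesis
      unfolding arrow_sign_def crossing_sign_def G_def using XY(1,2) by simp
  qed
  show ?thesis
    by (rule that[OF G asym R sign])
qed

section \<open>The 4-term relation\<close>

lemma bij_betw_transpose: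
  assumes "u \<in> S" "v \<in> S"
  shows "bij_betw (transpose u v) S S"
  using assms by (intro bij_betw_byWitness[of _ "transpose u v"]) (auto simp: transpose_def)

theorem theorem2p4:
  fixes k :: nat
  assumes "k \<ge> 2"
  shows "weight_system (R k)"
  unfolding weight_system_def Let_def
proof (intro allI impI)
  fix D :: "nat set set" and A B a b1 b2
  let ?m = "2 * card D"
  assume D: "chord_system D" and AB: "A \<in> D" "B \<in> D" "A \<noteq> B" and a: "a \<in> A" and B: "B = {b1, b2}"
    and "immediately_precedes ?m a b1 \<or> immediately_precedes ?m b1 a"
  then have nb: "neighbours ?m a b1"
    by (simp add: neighbours_def)
  define \<pi> where "\<pi> = move_along ?m a b1 b2"
  obtain s\<^sub>0 where s\<^sub>0: "chord_orientation D s\<^sub>0"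
    using chord_orientation_some[OF D] by blast
  \<comment> \<open>With these beginnings of \<open>A\<close> and \<open>B\<close>, the slide subtracts the row of \<open>B\<close> instead of adding it.\<close>
  define s where "s = s\<^sub>0(A := a, B := b1)"
  have s: "chord_orientation D s"
    using s\<^sub>0 a B by (auto simp: s_def chord_orientation_def)
  have ends: "C = {s C, chord_end s C}" "chord_end s C \<noteq> s C" if "C \<in> D" for C
    using that s chord_end[of C s] chord_systemD(3)[OF D] by (auto simp: chord_orientation_def)
  have mem: "s C \<in> C" "chord_end s C \<in> C" if "C \<in> D" for C
    using ends[OF that] by blast+
  have lt: "x < ?m" if "x \<in> C" "C \<in> D" for x C
    using chord_systemD(4)[OF D] that by blast
  have disj: "x \<notin> Y" if "x \<in> X" "X \<in> D" "Y \<in> D" "X \<noteq> Y" for x X Y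
    using chord_systemD(2)[OF D] that by (auto simp: disjoint_def)
  have sA: "s A = a" and sB: "s B = b1"
    using AB(3) by (simp_all add: s_def)
  have eB: "chord_end s B = b2" "b1 \<noteq> b2"
    using ends[OF AB(2)] B sB by (auto simp: doubleton_eq_iff)
  define a2 where "a2 = chord_end s A"
  have pts: "a < ?m" "a2 < ?m" "b1 < ?m" "b2 < ?m"
    "a \<noteq> b1" "a \<noteq> b2" "a2 \<noteq> a" "a2 \<noteq> b1" "a2 \<noteq> b2"
    using lt[OF a AB(1)] lt[of a2 A] lt[of b1 B] lt[of b2 B] AB B disj[OF a AB] disj[of a2 A B] mem[OF AB(1)] ends(2)[OF AB(1)]
    by (auto simp: a2_def sA)
  note \<pi> = move_along_correct[OF pts(1,3,4,5,6) eB(2) nb, folded \<pi>_def]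
  have \<pi>_lt: "\<pi> x < ?m" if "x < ?m" for x
    using bij_betwE[OF \<pi>(1)] that by auto
  have \<pi>_eq: "\<pi> x = \<pi> y \<longleftrightarrow> x = y" if "x < ?m" "y < ?m" for x y
    using bij_betw_imp_inj_on[OF \<pi>(1)] that by (simp add: inj_on_eq_iff)

  let ?\<tau> = "transpose a b1" and ?\<sigma> = "transpose (\<pi> a) (\<pi> b2) \<circ> \<pi>"
  have \<tau>: "bij_betw ?\<tau> {..<?m} {..<?m}" and \<sigma>: "bij_betw ?\<sigma> {..<?m} {..<?m}"
    using bij_betw_transpose pts \<pi>_lt by (auto intro!: bij_betw_trans[OF \<pi>(1)])
  have \<tau>_arc: "?\<tau> y \<in> arc ?m (?\<tau> x) (?\<tau> z) \<longleftrightarrow> y \<in> arc ?m x z"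
    if "x < ?m" "y < ?m" "z < ?m" "x \<noteq> y" "y \<noteq> z" "x \<noteq> z" "\<not> {a, b1} \<subseteq> {x, y, z}" for x y z
    using that by (intro transpose_neighbours_arc nb pts)
  have \<sigma>_arc: "?\<sigma> y \<in> arc ?m (?\<sigma> x) (?\<sigma> z) \<longleftrightarrow> \<pi> y \<in> arc ?m (\<pi> x) (\<pi> z)"
    if "x < ?m" "y < ?m" "z < ?m" "x \<noteq> y" "y \<noteq> z" "x \<noteq> z" "\<not> {a, b2} \<subseteq> {x, y, z}" for x y z
  proof -
    have "\<not> {\<pi> a, \<pi> b2} \<subseteq> {\<pi> x, \<pi> y, \<pi> z}"
      using that pts by (simp add: \<pi>_eq)
    then show ?thesis
      unfolding comp_apply using that pts
      by (intro transpose_neighbours_arc \<pi>(2) \<pi>_lt) (simp_all add: \<pi>_eq)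
  qed

  obtain G\<^sub>0 where G\<^sub>0: "G\<^sub>0 \<subseteq> D \<times> D" "asym G\<^sub>0"
    "R k (abs_chord_diagram (relocate id D)) = signed_polygon_count G\<^sub>0 (2 * k)"
    "\<And>X Y. X \<in> D \<Longrightarrow> Y \<in> D \<Longrightarrow> X \<noteq> Y \<Longrightarrow>
      arrow_sign G\<^sub>0 X Y = crossing_sign ?m id (s X) (chord_end s X) (s Y) (chord_end s Y)"
    using relocated_digraph[where k = k, OF D s bij_betw_id] by metis
  obtain G\<^sub>1 where G\<^sub>1: "G\<^sub>1 \<subseteq> D \<times> D" "asym G\<^sub>1"
    "R k (abs_chord_diagram (relocate ?\<tau> D)) = signed_polygon_count G\<^sub>1 (2 * k)"
    "\<And>X Y. X \<in> D \<Longrightarrow> Y \<in> D \<Longrightarrow> X \<noteq> Y \<Longrightarrow>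
      arrow_sign G\<^sub>1 X Y = crossing_sign ?m ?\<tau> (s X) (chord_end s X) (s Y) (chord_end s Y)"
    using relocated_digraph[where k = k, OF D s \<tau>] by metis
  obtain G\<^sub>2 where G\<^sub>2: "G\<^sub>2 \<subseteq> D \<times> D" "asym G\<^sub>2"
    "R k (abs_chord_diagram (relocate \<pi> D)) = signed_polygon_count G\<^sub>2 (2 * k)"
    "\<And>X Y. X \<in> D \<Longrightarrow> Y \<in> D \<Longrightarrow> X \<noteq> Y \<Longrightarrow>
      arrow_sign G\<^sub>2 X Y = crossing_sign ?m \<pi> (s X) (chord_end s X) (s Y) (chord_end s Y)"
    using relocated_digraph[where k = k, OF D s \<pi>(1)] by metis
  obtain G\<^sub>3 where G\<^sub>3: "G\<^sub>3 \<subseteq> D \<times> D" "asym G\<^sub>3"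
    "R k (abs_chord_diagram (relocate ?\<sigma> D)) = signed_polygon_count G\<^sub>3 (2 * k)"
    "\<And>X Y. X \<in> D \<Longrightarrow> Y \<in> D \<Longrightarrow> X \<noteq> Y \<Longrightarrow>
      arrow_sign G\<^sub>3 X Y = crossing_sign ?m ?\<sigma> (s X) (chord_end s X) (s Y) (chord_end s Y)"
    using relocated_digraph[where k = k, OF D s \<sigma>] by metis

  have distinct: "s X < ?m" "chord_end s X < ?m" "s Y < ?m" "chord_end s Y < ?m"
      "s X \<noteq> chord_end s X" "s Y \<noteq> s X" "s Y \<noteq> chord_end s X"
      "chord_end s Y \<noteq> s X" "chord_end s Y \<noteq> chord_end s X"
    if "X \<in> D" "Y \<in> D" "X \<noteq> Y" for X Y
    using lt mem ends(2) disj that by metis+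
  \<comment> \<open>The exchanges affect only triples that contain both neighbors, hence only the signs of \<open>A\<close> and \<open>B\<close>.\<close>
  have far: "\<not> {a, b} \<subseteq> X \<union> Y"
    if "X \<in> D" "Y \<in> D" "b \<in> B" "{X, Y} \<noteq> {A, B}" for X Y b
  proof
    assume *: "{a, b} \<subseteq> X \<union> Y"
    then have "X = A \<or> Y = A" "X = B \<or> Y = B"
      using disj[OF a AB(1)] disj[OF that(3) AB(2)] that(1,2) by blast+
    then show False using that(4) AB(3) by blast
  qed
  have loop: "arrow_sign G X X = 0" for G :: "(nat set \<times> nat set) set" and X
    by (simp add: arrow_sign_def)

  have change1: "arrow_sign G\<^sub>1 X Y = arrow_sign G\<^sub>0 X Y"
    if XY: "X \<in> D" "Y \<in> D" "{X, Y} \<noteq> {A, B}" for X Y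
  proof (cases "X = Y")
    case False
    have "\<not> {a, b1} \<subseteq> {s X, y, chord_end s X}" if "y \<in> Y" for y
      using far[OF XY(1,2) _ XY(3), of b1] B that mem[OF XY(1)] by blast
    then show ?thesis
      using distinct[OF XY(1,2) False] mem[OF XY(2)]
      by (simp add: crossing_sign_def G\<^sub>0(4)[OF XY(1,2) False] G\<^sub>1(4)[OF XY(1,2) False] \<tau>_arc)
  qed (simp add: loop)
  have change2: "arrow_sign G\<^sub>3 X Y = arrow_sign G\<^sub>2 X Y"
    if XY: "X \<in> D" "Y \<in> D" "{X, Y} \<noteq> {A, B}" for X Y
  proof (cases "X = Y")
    case False
    have "\<not> {a, b2} \<subseteq> {s X, y, chord_end s X}" if "y \<in> Y" for y
      using far[OF XY(1,2) _ XY(3), of b2] B that mem[OF XY(1)] by blast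
    then show ?thesis
      using distinct[OF XY(1,2) False] mem[OF XY(2)]
      by (simp add: crossing_sign_def G\<^sub>2(4)[OF XY(1,2) False] G\<^sub>3(4)[OF XY(1,2) False] \<sigma>_arc del: comp_apply)
  qed (simp add: loop)
  have slide1: "arrow_sign G\<^sub>2 X Y = arrow_sign G\<^sub>0 X Y"
    if XY: "X \<in> D - {A}" "Y \<in> D - {A}" for X Y
  proof (cases "X = Y")
    case False
    have XY': "X \<in> D" "Y \<in> D" using XY by auto
    have "a \<notin> {s X, y, chord_end s X}" if "y \<in> Y" for y
      using disj[OF a AB(1), of X] disj[OF a AB(1), of Y] that mem[OF XY'(1)] XY by blast
    then show ?thesis
      using distinct[OF XY' False] mem[OF XY'(2)]
      by (simp add: crossing_sign_def G\<^sub>0(4)[OF XY' False] G\<^sub>2(4)[OF XY' False] \<pi>(4))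
  qed (simp add: loop)
  have slide2: "arrow_sign G\<^sub>2 X A = arrow_sign G\<^sub>0 X A - arrow_sign G\<^sub>0 X B"
    if X: "X \<in> D - {A, B}" for X
  proof -
    have X': "X \<in> D" "X \<noteq> A" "X \<noteq> B" using X by auto
    let ?x = "s X" and ?x' = "chord_end s X"
    have off: "?x \<notin> {a, a2, b1, b2}" "?x' \<notin> {a, a2, b1, b2}" "?x \<noteq> ?x'" "?x < ?m" "?x' < ?m"
      using distinct[OF X'(1) AB(1) X'(2)] distinct[OF X'(1) AB(2) X'(3)] sA sB eB a2_def by auto
    \<comment> \<open>Seen from \<open>X\<close>, the end \<open>a\<close> is where \<open>b1\<close> is before the move, and where \<open>b2\<close> is after it.\<close>
    have "\<pi> a \<in> arc ?m (\<pi> ?x) (\<pi> ?x') \<longleftrightarrow> \<pi> b2 \<in> arc ?m (\<pi> ?x) (\<pi> ?x')"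
      using off pts by (intro neighbours_replace_arc(1)[OF \<pi>(2)] \<pi>_lt) (simp_all add: \<pi>_eq)
    also have "\<dots> \<longleftrightarrow> b2 \<in> arc ?m ?x ?x'"
      using off pts by (intro \<pi>(4)) auto
    finally have 1: "\<pi> a \<in> arc ?m (\<pi> ?x) (\<pi> ?x') \<longleftrightarrow> b2 \<in> arc ?m ?x ?x'" .
    have 2: "\<pi> a2 \<in> arc ?m (\<pi> ?x) (\<pi> ?x') \<longleftrightarrow> a2 \<in> arc ?m ?x ?x'"
      using off pts by (intro \<pi>(4)) auto
    have 3: "a \<in> arc ?m ?x ?x' \<longleftrightarrow> b1 \<in> arc ?m ?x ?x'"
      using off pts by (intro neighbours_replace_arc(1)[OF nb]) auto
    show ?thesis
      by (simp add: crossing_sign_def G\<^sub>0(4)[OF X'(1) AB(1) X'(2)] G\<^sub>0(4)[OF X'(1) AB(2) X'(3)]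
          G\<^sub>2(4)[OF X'(1) AB(1) X'(2)] sA sB eB a2_def[symmetric] 1 2 3)
  qed
  have jump: "arrow_sign G\<^sub>0 A B - arrow_sign G\<^sub>1 A B = arrow_sign G\<^sub>2 A B - arrow_sign G\<^sub>3 A B"
  proof -
    \<comment> \<open>Only the indicator of \<open>a\<close> depends on the diagram; each exchange negates it, the move keeps it.\<close>
    have 1: "?\<tau> a2 \<in> arc ?m (?\<tau> b1) (?\<tau> b2) \<longleftrightarrow> a2 \<in> arc ?m b1 b2"
      using pts eB(2) by (intro \<tau>_arc) auto
    have 2: "\<pi> a2 \<in> arc ?m (\<pi> b1) (\<pi> b2) \<longleftrightarrow> a2 \<in> arc ?m b1 b2"
      using pts by (intro \<pi>(4)) auto
    have 3: "?\<sigma> a2 \<in> arc ?m (?\<sigma> b1) (?\<sigma> b2) \<longleftrightarrow> a2 \<in> arc ?m b1 b2"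
      unfolding 2[symmetric] using pts eB(2) by (intro \<sigma>_arc) auto
    have "?\<tau> b1 = a" "?\<tau> a = b1" "?\<tau> b2 = b2"
      using pts eB(2) by (simp_all add: transpose_def)
    then have 4: "?\<tau> a \<in> arc ?m (?\<tau> b1) (?\<tau> b2) \<longleftrightarrow> a \<notin> arc ?m b1 b2"
      using arc_swap(1)[of b1 ?m a b2] pts eB(2) by auto
    have "?\<sigma> b1 = \<pi> b1" "?\<sigma> a = \<pi> b2" "?\<sigma> b2 = \<pi> a"
      using pts eB(2) by (simp_all add: transpose_def \<pi>_eq)
    then have "?\<sigma> a \<in> arc ?m (?\<sigma> b1) (?\<sigma> b2) \<longleftrightarrow> \<pi> a \<notin> arc ?m (\<pi> b1) (\<pi> b2)"
      using arc_swap(2)[of "\<pi> b1" ?m "\<pi> a" "\<pi> b2"] pts eB(2) \<pi>_lt \<pi>_eq by metis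
    then have 5: "?\<sigma> a \<in> arc ?m (?\<sigma> b1) (?\<sigma> b2) \<longleftrightarrow> a \<notin> arc ?m b1 b2"
      unfolding \<pi>(3) .
    have sign: "arrow_sign G A B = - arrow_sign G B A" for G
      by (rule arrow_sign_swap)
    show ?thesis
      unfolding sign G\<^sub>0(4)[OF AB(2,1) AB(3)[symmetric]] G\<^sub>1(4)[OF AB(2,1) AB(3)[symmetric]]
        G\<^sub>2(4)[OF AB(2,1) AB(3)[symmetric]] G\<^sub>3(4)[OF AB(2,1) AB(3)[symmetric]]
        sA sB eB(1) a2_def[symmetric] crossing_sign_def id_apply 1 2 3 4 5 \<pi>(3) by simp
  qed

  \<comment> \<open>For \<open>k \<ge> 2\<close> there is at least one inner vertex.\<close>
  have n: "even (2 * k - 2)" "2 * k - 2 > 0" "2 * k - 2 + 2 = 2 * k"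
    using assms by auto
  have "finite D"
    using chord_systemD(1)[OF D] by (metis finite_UnionD finite_lessThan)
  then have "signed_polygon_count G\<^sub>0 (2 * k - 2 + 2) - signed_polygon_count G\<^sub>1 (2 * k - 2 + 2) =
      signed_polygon_count G\<^sub>2 (2 * k - 2 + 2) - signed_polygon_count G\<^sub>3 (2 * k - 2 + 2)"
    by (rule four_term_digraphs[OF _ AB n(1,2) G\<^sub>0(1) G\<^sub>1(1) G\<^sub>2(1) G\<^sub>3(1)
          G\<^sub>0(2) G\<^sub>1(2) G\<^sub>2(2) G\<^sub>3(2) _ _ _ _ jump]) (fact change1 change2 slide1 slide2)+
  then have "signed_polygon_count G\<^sub>0 (2 * k) - signed_polygon_count G\<^sub>1 (2 * k) =
      signed_polygon_count G\<^sub>2 (2 * k) - signed_polygon_count G\<^sub>3 (2 * k)"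
    unfolding n(3) .
  moreover have "relocate id D = D"
    by (simp add: relocate_def)
  moreover have "relocate ?\<sigma> D = exchange_ends (\<pi> a) (\<pi> b2) (relocate \<pi> D)"
    by (simp add: relocate_def exchange_ends_def image_image image_comp[symmetric])
  ultimately show "R k (abs_chord_diagram D) - R k (abs_chord_diagram (exchange_ends a b1 D)) =
      R k (abs_chord_diagram (relocate (move_along ?m a b1 b2) D)) -
      R k (abs_chord_diagram (exchange_ends (move_along ?m a b1 b2 a) (move_along ?m a b1 b2 b2)
        (relocate (move_along ?m a b1 b2) D)))"
    using G\<^sub>0(3) G\<^sub>1(3) G\<^sub>2(3) G\<^sub>3(3) by (simp add: \<pi>_def exchange_ends_def)
qed

end
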